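(* Let $1\le r<\min\{m,n\}$ and $G,\widetilde G=G+E\in\mathbb{C}^{m\times n}$. Let $U\in\mathbb{C}^{m\times m}$ and $V\in\mathbb{C}^{n\times n}$ be unitary such that $$U^{H}GV=\begin{bmatrix} G_1 & 0 \\ 0 & G_2 \end{bmatrix},\qquad U^{H}\widetilde GV=\begin{bmatrix} G_1+E_{11} & E_{12} \\ E_{21} & G_2+E_{22} \end{bmatrix},$$ where $G_1,E_{11}\in\mathbb{C}^{r\times r}$, $E_{12}\in\mathbb{C}^{r\times(n-r)}$, $E_{21}\in\mathbb{C}^{(m-r)\times r}$, $G_2,E_{22}\in\mathbb{C}^{(m-r)\times(n-r)}$. Let $$\delta=\min_{\mu\in\mathrm{sv}(G_1),\,\nu\in\mathrm{sv}_{\mathrm{ext}}(G_2)}|\mu-\nu|,\quad \underline\delta=\delta-\|E_{11}\|_2-\|E_{22}\|_2,\quad \varepsilon=\max\{\|E_{12}\|_2,\|E_{21}\|_2\},$$ and consider the following system for $(\Gamma,\Omega)\in\mathbb{C}^{(m-r)\times r}\times\mathbb{C}^{(n-r)\times r}$: $$(\ast)\quad \Gamma(G_1+E_{11})-(G_2+E_{22})\Omega=E_{21}-\Gamma E_{12}\Omega,\qquad \Omega(G_1+E_{11})^{H}-(G_2+E_{22})^{H}\Gamma=E_{12}^{H}-\Omega E_{21}^{H}\Gamma .$$ (i) If $\underline\delta>0$ and $\kappa_2:=\frac{\varepsilon}{\underline\delta^2}\sqrt{\|E_{12}\|_F^2+\|E_{21}\|_F^2}<\frac14$, then $(\ast)$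 has a solution $(\Gamma,\Omega)$ that satisfies $$\sqrt{\|\Gamma\|_F^2+\|\Omega\|_F^2}\le\frac{1+\sqrt{1-4\kappa_2}}{1-2\kappa_2+\sqrt{1-4\kappa_2}}\,\frac{\sqrt{\|E_{12}\|_F^2+\|E_{21}\|_F^2}}{\underline\delta}<2\,\frac{\sqrt{\|E_{12}\|_F^2+\|E_{21}\|_F^2}}{\underline\delta}.$$ (ii) If $\sigma_{\min}(G_1)>\sigma_{\max}(G_2)$ and if $\underline\delta>0$ and $\kappa_2:=\frac{\varepsilon}{\underline\delta^2}\max\{\|E_{12}\|_F,\|E_{21}\|_F\}<\frac14$, then $(\ast)$ has a solution $(\Gamma,\Omega)$ that satisfies $$\max\{\|\Gamma\|_F,\|\Omega\|_F\}\le\frac{1+\sqrt{1-4\kappa_2}}{1-2\kappa_2+\sqrt{1-4\kappa_2}}\,\frac{\max\{\|E_{12}\|_F,\|E_{21}\|_F\}}{\underline\delta}<2\,\frac{\max\{\|E_{12}\|_F,\|E_{21}\|_F\}}{\underline\delta}.$$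
   Context: $X^H$ is the conjugate transpose; $\|\cdot\|_2$ and $\|\cdot\|_F$ are the spectral and Frobenius norms. A matrix $B\in\mathbb{C}^{p\times q}$ has $\min\{p,q\}$ singular values $\sigma_1(B)\ge\dots\ge\sigma_{\min\{p,q\}}(B)$; $\sigma_{\max}(B)=\sigma_1(B)$, $\sigma_{\min}(B)=\sigma_{\min\{p,q\}}(B)$; $\mathrm{sv}(B)$ is the multiset of these singular values and $\mathrm{sv}_{\mathrm{ext}}(B)$ is $\mathrm{sv}(B)$ together with $|p-q|$ additional copies of $0$.
   Formalization: The final strict inequality in (i) and (ii) is asserted only when E_{12} and E_{21} are not both zero; if both vanish it would read 0 < 0 (e.g. G = diag(1,0), E = 0, r = 1). Existence and the first bound are asserted in all cases. *)

theory Defs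
  imports
    "Jordan_Normal_Form.Char_Poly"
    "Jordan_Normal_Form.Schur_Decomposition"
    "HOL-Computational_Algebra.Fundamental_Theorem_Algebra"
    "HOL-Library.Multiset"
begin

definition unitary_mat :: "nat \<Rightarrow> complex mat \<Rightarrow> bool" where
  "unitary_mat k U \<longleftrightarrow>
     U \<in> carrier_mat k k \<and> mat_adjoint U * U = 1\<^sub>m k \<and> U * mat_adjoint U = 1\<^sub>m k"

definition euclid_norm :: "complex vec \<Rightarrow> real" where
  "euclid_norm x = sqrt (\<Sum>i<dim_vec x. (cmod (x $ i))\<^sup>2)"

definition frob_norm :: "complex mat \<Rightarrow> real" where
  "frob_norm A = sqrt (\<Sum>i<dim_row A. \<Sum>j<dim_col A. (cmod (A $$ (i, j)))\<^sup>2)"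

text \<open>The spectral norm, as the operator norm induced by the Euclidean norm.
  The unit ball (rather than the unit sphere) keeps the supremum over a nonempty set
  even for a matrix without columns.\<close>
definition spectral_norm :: "complex mat \<Rightarrow> real" where
  "spectral_norm A =
     (SUP x\<in>{x \<in> carrier_vec (dim_col A). euclid_norm x \<le> 1}. euclid_norm (A *\<^sub>v x))"

text \<open>The singular values of a \<open>p \<times> q\<close> matrix are the square roots of the eigenvalues, counted
  with algebraic multiplicity, of its smaller Gram matrix, so there are exactly \<open>min p q\<close> of
  them. The Gram matrix is Hermitian and positive semidefinite, hence its eigenvalues are real
  and \<open>Re\<close> only changes the type.\<close>
definition sv :: "complex mat \<Rightarrow> real multiset" where
  "sv B = image_mset (\<lambda>z. sqrt (Re z)) (proots (char_poly
     (if dim_col B \<le> dim_row B then mat_adjoint B * B else B * mat_adjoint B)))"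

lemma size_sv: "size (sv B) = min (dim_row B) (dim_col B)"
proof -
  have B: "B \<in> carrier_mat (dim_row B) (dim_col B)"
    by (rule carrier_matI) (rule refl)+
  have adj: "mat_adjoint B \<in> carrier_mat (dim_col B) (dim_row B)"
    by (intro carrier_matI) (simp_all only: mat_adjoint_def mat_of_rows_carrier length_map cols_length)
  have deg: "degree (char_poly A) = k" if "A \<in> carrier_mat k k" for A :: "complex mat" and k
    using degree_monic_char_poly[OF that] by (rule conjunct1)
  note tall = deg[OF mult_carrier_mat[OF adj B]]
  note wide = deg[OF mult_carrier_mat[OF B adj]]
  show ?thesis
    unfolding sv_def size_image_mset size_proots_complex if_distrib[of char_poly]
      if_distrib[of degree] tall wide by (simp add: min_def)
qed

text \<open>The absolute value of \<open>p - q\<close> is written as a sum of two truncated differences.\<close>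
definition sv_ext :: "complex mat \<Rightarrow> real multiset" where
  "sv_ext B = sv B +
     replicate_mset ((dim_row B - dim_col B) + (dim_col B - dim_row B)) 0"

definition singular_values :: "complex mat \<Rightarrow> real list" where
  "singular_values B = rev (sorted_list_of_multiset (sv B))"

text \<open>Indices start at 0: \<open>\<sigma>\<^sub>i\<close> is the entry at position \<open>i - 1\<close> of the decreasing list.\<close>
definition sigma_max :: "complex mat \<Rightarrow> real" where
  "sigma_max B = singular_values B ! 0"

definition sigma_min :: "complex mat \<Rightarrow> real" where
  "sigma_min B = singular_values B ! (min (dim_row B) (dim_col B) - 1)"

definition coupled_system ::
  "complex mat \<Rightarrow> complex mat \<Rightarrow> complex mat \<Rightarrow> complex mat \<Rightarrow> complex mat \<Rightarrow> complex mat \<Rightarrow>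
   complex mat \<Rightarrow> complex mat \<Rightarrow> bool" where
  "coupled_system G1 G2 E11 E12 E21 E22 \<Gamma> \<Omega> \<longleftrightarrow>
     \<Gamma> * (G1 + E11) - (G2 + E22) * \<Omega> = E21 - \<Gamma> * E12 * \<Omega> \<and>
     \<Omega> * mat_adjoint (G1 + E11) - mat_adjoint (G2 + E22) * \<Gamma>
       = mat_adjoint E12 - \<Omega> * mat_adjoint E21 * \<Gamma>"

end

theory Submission
  imports "HOL-Analysis.Urysohn" Defs
begin

text \<open>
The system is a quadratic perturbation of a linear equation. Let \<open>T\<close> be the operator
\<open>(\<Gamma>, \<Omega>) \<mapsto> (\<Gamma> G1 - G2 \<Omega>, \<Omega> G1\<^sup>H - G2\<^sup>H \<Gamma>)\<close>. Then the system reads \<open>T x = c - P x - B x\<close> with the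
constant \<open>c = (E21, E12\<^sup>H)\<close>, the linear map \<open>P\<close> made from \<open>E11\<close> and \<open>E22\<close> in the way in which \<open>T\<close> is made
from \<open>G1\<close> and \<open>G2\<close>, and the quadratic map \<open>B (\<Gamma>, \<Omega>) = (\<Gamma> E12 \<Omega>, \<Omega> E21\<^sup>H \<Gamma>)\<close>. If \<open>T\<close> is onto and
\<open>\<parallel>T x\<parallel> \<ge> \<delta> \<parallel>x\<parallel>\<close>, then \<open>x \<mapsto> T\<^sup>-\<^sup>1 (c - P x - B x)\<close> maps the ball whose radius \<open>b\<close> satisfies
\<open>\<eta> + \<epsilon> b\<^sup>2 = (\<delta> - \<parallel>E11\<parallel> - \<parallel>E22\<parallel>) b\<close>, with spectral norms on the right
and \<open>\<eta> = \<parallel>c\<parallel>\<close>, into itself. It is a contraction there, because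
\<open>\<kappa> < 1/4\<close> makes \<open>b\<close> a simple root. The claimed bound is this root, written differently
(\<open>minimal_radius\<close>), so Banach's fixed point theorem gives the solution
(\<open>coupled_system_solution_in_ball\<close>). The argument uses few properties of the norm on pairs, so it
applies to the Euclidean and to the maximum combination of the two Frobenius norms.

It remains to invert \<open>T\<close>. For the dilations \<open>H1\<close> and \<open>H2\<close> of \<open>G1\<close> and \<open>G2\<close>, where a matrix \<open>G\<close> has the
Hermitian dilation with rows \<open>(0, G)\<close> and \<open>(G\<^sup>H, 0)\<close>, the Sylvester operator \<open>Y \<mapsto> Y H1 - H2 Y\<close> maps
the block diagonal matrix with blocks \<open>\<Gamma>\<close>, \<open>\<Omega>\<close> to the block off-diagonal matrix with the blocks
\<open>T (\<Gamma>, \<Omega>)\<close> (\<open>block_diag_sylvester\<close>). By the spectral theorem for Hermitian matrices a Sylvester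
operator is diagonal in suitable unitary coordinates, with the differences of eigenvalues as
entries. The eigenvalues of the dilations are, up to sign, singular values
(\<open>abs_dilation_eigenvalue_in_sv_ext\<close>; for \<open>G2\<close> including the additional zeros), so these differences
are at least \<open>\<delta>\<close> in absolute value. This shows that \<open>T\<close> is onto and gives the lower bound in the
Euclidean combination. For the maximum combination the lower bound follows from
\<open>\<parallel>\<Gamma> G1\<parallel> \<ge> \<sigma>\<^sub>m\<^sub>i\<^sub>n(G1) \<parallel>\<Gamma>\<parallel>\<close> and \<open>\<parallel>G2 \<Omega>\<parallel> \<le> \<sigma>\<^sub>m\<^sub>a\<^sub>x(G2) \<parallel>\<Omega>\<parallel>\<close> and their adjoint versions, because
the separation of the singular values gives \<open>\<delta> \<le> \<sigma>\<^sub>m\<^sub>i\<^sub>n(G1) - \<sigma>\<^sub>m\<^sub>a\<^sub>x(G2)\<close>.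
\<close>

(* Otherwise the indexing of vectors of the two libraries has the same notation. *)
unbundle no vec_syntax

section \<open>Adjoints and norms\<close>

lemma dim_mat_adjoint [simp]:
  "dim_row (mat_adjoint A) = dim_col A" "dim_col (mat_adjoint A) = dim_row A"
  by (simp_all add: mat_adjoint_def)

lemma mat_adjoint_carrier [simp]: "A \<in> carrier_mat p q \<Longrightarrow> mat_adjoint A \<in> carrier_mat q p"
  by (auto intro!: carrier_matI)

lemma index_mat_adjoint [simp]:
  "i < dim_col A \<Longrightarrow> j < dim_row A \<Longrightarrow> mat_adjoint A $$ (i, j) = cnj (A $$ (j, i))"
  by (simp add: mat_adjoint_def mat_of_rows_def)

lemma mat_adjoint_adjoint [simp]:
  fixes A :: "complex mat"
  shows "mat_adjoint (mat_adjoint A) = A"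
  by (rule eq_matI) auto

lemma mat_adjoint_add:
  fixes A B :: "complex mat"
  assumes "A \<in> carrier_mat p q" "B \<in> carrier_mat p q"
  shows "mat_adjoint (A + B) = mat_adjoint A + mat_adjoint B"
  by (rule eq_matI) (use assms in auto)

lemma mat_adjoint_mult:
  fixes A B :: "complex mat"
  assumes "A \<in> carrier_mat p q" "B \<in> carrier_mat q s"
  shows "mat_adjoint (A * B) = mat_adjoint B * mat_adjoint A"
  by (rule eq_matI) (use assms in \<open>auto simp: scalar_prod_def mult.commute intro!: sum.cong\<close>)

lemma mat_adjoint_zero [simp]: "mat_adjoint (0\<^sub>m p q :: complex mat) = 0\<^sub>m q p"
  by (rule eq_matI) auto

lemma mat_adjoint_one [simp]: "mat_adjoint (1\<^sub>m p :: complex mat) = 1\<^sub>m p"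
  by (rule eq_matI) auto

lemma mat_adjoint_four_block:
  fixes A B C D :: "complex mat"
  assumes "A \<in> carrier_mat p q" "B \<in> carrier_mat p s" "C \<in> carrier_mat k q" "D \<in> carrier_mat k s"
  shows "mat_adjoint (four_block_mat A B C D)
    = four_block_mat (mat_adjoint A) (mat_adjoint C) (mat_adjoint B) (mat_adjoint D)"
  by (rule eq_matI) (use assms in auto)

lemma euclid_norm_L2_set: "euclid_norm x = L2_set (\<lambda>i. cmod (x $ i)) {..<dim_vec x}"
  by (simp add: euclid_norm_def L2_set_def)

lemma frob_norm_L2_set:
  "frob_norm A = L2_set (\<lambda>ij. cmod (A $$ ij)) ({..<dim_row A} \<times> {..<dim_col A})"
  by (simp add: frob_norm_def L2_set_def sum.cartesian_product split_def)

text \<open>The columnwise reading turns statements about the Euclidean norm of \<open>A *\<^sub>v x\<close> into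
statements about the Frobenius norm of \<open>A * B\<close>.\<close>
lemma frob_norm_cols: "frob_norm A = L2_set (\<lambda>j. euclid_norm (col A j)) {..<dim_col A}"
proof -
  have "(\<Sum>i<dim_row A. \<Sum>j<dim_col A. (cmod (A $$ (i, j)))\<^sup>2)
      = (\<Sum>j<dim_col A. \<Sum>i<dim_row A. (cmod (A $$ (i, j)))\<^sup>2)"
    by (rule sum.swap)
  then show ?thesis
    by (simp add: frob_norm_def L2_set_def euclid_norm_def sum_nonneg)
qed

lemma euclid_norm_nonneg [simp]: "0 \<le> euclid_norm x"
  by (simp add: euclid_norm_L2_set)

lemma frob_norm_nonneg [simp]: "0 \<le> frob_norm A"
  by (simp add: frob_norm_L2_set)

lemma frob_norm_add:
  assumes "A \<in> carrier_mat p q" "B \<in> carrier_mat p q"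
  shows "frob_norm (A + B) \<le> frob_norm A + frob_norm B"
proof -
  let ?I = "{..<p} \<times> {..<q}"
  have "frob_norm (A + B) = L2_set (\<lambda>ij. cmod (A $$ ij + B $$ ij)) ?I"
    unfolding frob_norm_L2_set using assms by (intro L2_set_cong) auto
  also have "\<dots> \<le> L2_set (\<lambda>ij. cmod (A $$ ij) + cmod (B $$ ij)) ?I"
    by (intro L2_set_mono norm_triangle_ineq) auto
  also have "\<dots> \<le> frob_norm A + frob_norm B"
    unfolding frob_norm_L2_set using assms L2_set_triangle_ineq by auto
  finally show ?thesis .
qed

lemma frob_norm_uminus: "frob_norm (- A) = frob_norm A"
  by (simp add: frob_norm_def)

lemma frob_norm_minus_commute:
  assumes "A \<in> carrier_mat p q" "B \<in> carrier_mat p q"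
  shows "frob_norm (A - B) = frob_norm (B - A)"
  using assms by (simp add: frob_norm_def norm_minus_commute)

lemma frob_norm_minus:
  assumes "A \<in> carrier_mat p q" "B \<in> carrier_mat p q"
  shows "frob_norm (A - B) \<le> frob_norm A + frob_norm B"
  using frob_norm_add[of A p q "- B"] assms
  by (simp add: frob_norm_uminus minus_add_uminus_mat[of A p q B])

lemma frob_norm_triangle_sub:
  assumes "A \<in> carrier_mat p q" "B \<in> carrier_mat p q"
  shows "frob_norm A \<le> frob_norm (A - B) + frob_norm B"
proof -
  have "(A - B) + B = A" using assms by (intro eq_matI) auto
  then show ?thesis using frob_norm_add[OF minus_carrier_mat[OF assms(2), of A] assms(2)] by simp
qed

lemma frob_norm_triangle_diff:
  assumes A: "A \<in> carrier_mat p q" and B: "B \<in> carrier_mat p q" and C: "C \<in> carrier_mat p q"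
  shows "frob_norm (A - C) \<le> frob_norm (A - B) + frob_norm (B - C)"
proof -
  have "(A - B) + (B - C) = A - C" using assms by (intro eq_matI) auto
  then show ?thesis
    using frob_norm_add[OF minus_carrier_mat[OF B, of A] minus_carrier_mat[OF C, of B]] by simp
qed

lemma frob_norm_zero [simp]: "frob_norm (0\<^sub>m p q) = 0"
  by (simp add: frob_norm_def)

lemma frob_norm_eq_0:
  assumes "A \<in> carrier_mat p q" "frob_norm A = 0"
  shows "A = 0\<^sub>m p q"
  using assms by (auto simp: frob_norm_L2_set L2_set_eq_0_iff)

lemma cmod_index_le_frob_norm:
  assumes "i < dim_row A" "j < dim_col A"
  shows "cmod (A $$ (i, j)) \<le> frob_norm A"
  unfolding frob_norm_L2_set
  using member_le_L2_set[of "{..<dim_row A} \<times> {..<dim_col A}" "(i, j)" "\<lambda>ij. cmod (A $$ ij)"] assms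
  by simp

lemma frob_norm_adjoint [simp]: "frob_norm (mat_adjoint A) = frob_norm A"
proof -
  have "(\<Sum>i<dim_row A. \<Sum>j<dim_col A. (cmod (A $$ (i, j)))\<^sup>2)
      = (\<Sum>j<dim_col A. \<Sum>i<dim_row A. (cmod (A $$ (i, j)))\<^sup>2)"
    by (rule sum.swap)
  then show ?thesis by (simp add: frob_norm_def)
qed

lemma frob_norm_four_block:
  assumes "A \<in> carrier_mat p q" "B \<in> carrier_mat p s" "C \<in> carrier_mat k q" "D \<in> carrier_mat k s"
  shows "(frob_norm (four_block_mat A B C D))\<^sup>2
    = (frob_norm A)\<^sup>2 + (frob_norm B)\<^sup>2 + (frob_norm C)\<^sup>2 + (frob_norm D)\<^sup>2"
proof -
  have split: "(\<Sum>i<a + b. f i) = (\<Sum>i<a. f i) + (\<Sum>i<b. f (a + i))" for a b and f :: "nat \<Rightarrow> real"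
    by (induction b) auto
  show ?thesis
    using assms by (simp add: frob_norm_def sum_nonneg split sum.distrib)
qed

lemma cscalar_prod_cauchy_schwarz:
  assumes "dim_vec x = dim_vec y"
  shows "cmod (x \<bullet>c y) \<le> euclid_norm x * euclid_norm y"
proof -
  have "cmod (x \<bullet>c y) \<le> (\<Sum>i<dim_vec y. cmod (x $ i) * cmod (y $ i))"
    unfolding scalar_prod_def
    by (rule order_trans[OF norm_sum]) (auto simp: norm_mult lessThan_atLeast0)
  also have "\<dots> \<le> euclid_norm x * euclid_norm y"
    using L2_set_mult_ineq[of "\<lambda>i. cmod (x $ i)" "\<lambda>i. cmod (y $ i)" "{..<dim_vec y}"] assms
    by (simp add: euclid_norm_L2_set)
  finally show ?thesis .
qed

lemma cscalar_prod_self: "x \<bullet>c x = complex_of_real ((euclid_norm x)\<^sup>2)"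
  by (simp add: scalar_prod_def euclid_norm_def sum_nonneg lessThan_atLeast0
      complex_norm_square of_real_sum del: of_real_power of_real_mult)

lemma cscalar_prod_adjoint:
  fixes A :: "complex mat"
  assumes A: "A \<in> carrier_mat p q" and x: "x \<in> carrier_vec q" and y: "y \<in> carrier_vec p"
  shows "(A *\<^sub>v x) \<bullet>c y = x \<bullet>c (mat_adjoint A *\<^sub>v y)"
proof -
  have "(A *\<^sub>v x) \<bullet>c y = (\<Sum>i<p. \<Sum>j<q. A $$ (i, j) * x $ j * cnj (y $ i))"
    using assms by (simp add: scalar_prod_def lessThan_atLeast0 sum_distrib_right)
  also have "\<dots> = (\<Sum>j<q. \<Sum>i<p. A $$ (i, j) * x $ j * cnj (y $ i))"
    by (rule sum.swap)
  also have "\<dots> = x \<bullet>c (mat_adjoint A *\<^sub>v y)"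
    using assms by (simp add: scalar_prod_def lessThan_atLeast0 sum_distrib_left mult_ac)
  finally show ?thesis .
qed

lemma euclid_norm_mult_le_frob_norm:
  assumes A: "A \<in> carrier_mat p q" and x: "x \<in> carrier_vec q"
  shows "euclid_norm (A *\<^sub>v x) \<le> frob_norm A * euclid_norm x"
proof -
  have row: "cmod (row A i \<bullet> x) \<le> euclid_norm (row A i) * euclid_norm x" if "i < p" for i
    using cscalar_prod_cauchy_schwarz[of "row A i" "conjugate x"] that assms
    by (simp add: euclid_norm_def)
  have "euclid_norm (A *\<^sub>v x) \<le> L2_set (\<lambda>i. euclid_norm (row A i) * euclid_norm x) {..<p}"
    unfolding euclid_norm_L2_set[of "A *\<^sub>v x"] using A row
    by (auto intro!: L2_set_mono)
  also have "\<dots> = frob_norm A * euclid_norm x"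
    using A by (simp add: L2_set_left_distrib[symmetric])
      (simp add: frob_norm_def euclid_norm_def L2_set_def sum_nonneg)
  finally show ?thesis .
qed

lemma euclid_norm_smult: "euclid_norm (c \<cdot>\<^sub>v x) = cmod c * euclid_norm x"
  by (auto simp: euclid_norm_L2_set norm_mult L2_set_right_distrib intro!: L2_set_cong)

lemma euclid_norm_eq_0:
  assumes "x \<in> carrier_vec k"
  shows "euclid_norm x = 0 \<longleftrightarrow> x = 0\<^sub>v k"
  using assms by (auto simp: euclid_norm_L2_set L2_set_eq_0_iff)

lemma spectral_norm_upper:
  assumes "x \<in> carrier_vec (dim_col A)" "euclid_norm x \<le> 1"
  shows "euclid_norm (A *\<^sub>v x) \<le> spectral_norm A"
proof -
  have "bdd_above ((\<lambda>y. euclid_norm (A *\<^sub>v y)) ` {y \<in> carrier_vec (dim_col A). euclid_norm y \<le> 1})"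
  proof (rule bdd_aboveI2)
    fix y assume "y \<in> {y \<in> carrier_vec (dim_col A). euclid_norm y \<le> 1}"
    then show "euclid_norm (A *\<^sub>v y) \<le> frob_norm A"
      using euclid_norm_mult_le_frob_norm[of A "dim_row A" "dim_col A" y]
        mult_left_mono[of "euclid_norm y" 1 "frob_norm A"] by auto
  qed
  then show ?thesis
    unfolding spectral_norm_def by (rule cSUP_upper[rotated]) (use assms in auto)
qed

lemma euclid_norm_mult_le_spectral_norm:
  assumes A: "A \<in> carrier_mat p q" and x: "x \<in> carrier_vec q"
  shows "euclid_norm (A *\<^sub>v x) \<le> spectral_norm A * euclid_norm x"
proof (cases "x = 0\<^sub>v q")
  case True
  have "A *\<^sub>v 0\<^sub>v q = 0\<^sub>v p" using A by (auto intro!: eq_vecI)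
  with True show ?thesis by (simp add: euclid_norm_def)
next
  case False
  with x have pos: "euclid_norm x > 0"
    using euclid_norm_eq_0[OF x] by (simp add: order_less_le)
  define c where "c = complex_of_real (1 / euclid_norm x)"
  have c: "cmod c = 1 / euclid_norm x" using pos by (simp add: c_def norm_divide)
  have unit: "euclid_norm (c \<cdot>\<^sub>v x) = 1" using pos by (simp add: euclid_norm_smult c)
  have "euclid_norm (A *\<^sub>v (c \<cdot>\<^sub>v x)) \<le> spectral_norm A"
    by (rule spectral_norm_upper) (use x A unit in auto)
  then have "euclid_norm (A *\<^sub>v x) / euclid_norm x \<le> spectral_norm A"
    using A x by (simp add: mult_mat_vec euclid_norm_smult c)
  then show ?thesis using pos by (simp add: divide_simps)
qed

lemma spectral_norm_nonneg: "0 \<le> spectral_norm A"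
proof -
  have "euclid_norm (A *\<^sub>v 0\<^sub>v (dim_col A)) \<le> spectral_norm A"
    by (rule spectral_norm_upper) (auto simp: euclid_norm_def)
  then show ?thesis by (rule order_trans[rotated]) simp
qed

text \<open>With \<open>z = A\<^sup>H y\<close>, Cauchy-Schwarz gives
\<open>\<parallel>z\<parallel>\<^sup>2 = \<langle>A z, y\<rangle> \<le> \<parallel>A\<parallel> \<parallel>z\<parallel> \<parallel>y\<parallel>\<close>, and a factor \<open>\<parallel>z\<parallel>\<close> cancels. So the adjoint has no
larger operator norm, and multiplication from the right can be estimated like multiplication
from the left.\<close>
lemma euclid_norm_adjoint_mult_le_spectral_norm:
  assumes A: "A \<in> carrier_mat p q" and y: "y \<in> carrier_vec p"
  shows "euclid_norm (mat_adjoint A *\<^sub>v y) \<le> spectral_norm A * euclid_norm y"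
proof -
  let ?z = "mat_adjoint A *\<^sub>v y"
  have z: "?z \<in> carrier_vec q"
    using mat_adjoint_carrier[OF A] y by (rule mult_mat_vec_carrier)
  have "complex_of_real ((euclid_norm ?z)\<^sup>2) = (A *\<^sub>v ?z) \<bullet>c y"
    using cscalar_prod_adjoint[OF A z y] by (simp add: cscalar_prod_self)
  then have "(euclid_norm ?z)\<^sup>2 = cmod ((A *\<^sub>v ?z) \<bullet>c y)"
    by (metis norm_of_real abs_of_nonneg zero_le_power2)
  also have "\<dots> \<le> euclid_norm (A *\<^sub>v ?z) * euclid_norm y"
    by (rule cscalar_prod_cauchy_schwarz) (use A y in auto)
  also have "\<dots> \<le> (spectral_norm A * euclid_norm ?z) * euclid_norm y"
    by (intro mult_right_mono euclid_norm_mult_le_spectral_norm[OF A z]) auto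
  finally have *: "euclid_norm ?z * euclid_norm ?z \<le> (spectral_norm A * euclid_norm y) * euclid_norm ?z"
    by (simp add: power2_eq_square mult_ac)
  show ?thesis
  proof (cases "euclid_norm ?z = 0")
    case True
    then show ?thesis by (simp add: spectral_norm_nonneg)
  next
    case False
    then have "euclid_norm ?z > 0" by (simp add: order_less_le)
    with * show ?thesis by simp
  qed
qed

lemma frob_norm_mult_le:
  assumes A: "A \<in> carrier_mat p q" and B: "B \<in> carrier_mat q s" and c: "0 \<le> c"
    and le: "\<And>x. x \<in> carrier_vec q \<Longrightarrow> euclid_norm (A *\<^sub>v x) \<le> c * euclid_norm x"
  shows "frob_norm (A * B) \<le> c * frob_norm B"
proof -
  have "frob_norm (A * B) = L2_set (\<lambda>j. euclid_norm (A *\<^sub>v col B j)) {..<s}"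
    unfolding frob_norm_cols
    by (intro L2_set_cong) (use B in \<open>auto simp: col_mult2[OF A B] simp del: col_mult\<close>)
  also have "\<dots> \<le> L2_set (\<lambda>j. c * euclid_norm (col B j)) {..<s}"
    using B by (intro L2_set_mono le) auto
  also have "\<dots> = c * frob_norm B"
    using B c by (simp add: frob_norm_cols flip: L2_set_right_distrib)
  finally show ?thesis .
qed

lemma frob_norm_mult:
  assumes "A \<in> carrier_mat p q" "B \<in> carrier_mat q s"
  shows "frob_norm (A * B) \<le> frob_norm A * frob_norm B"
  using frob_norm_mult_le[OF assms, of "frob_norm A"] euclid_norm_mult_le_frob_norm[OF assms(1)] by simp

lemma frob_norm_mult_spectral_left:
  assumes "A \<in> carrier_mat p q" "B \<in> carrier_mat q s"
  shows "frob_norm (A * B) \<le> spectral_norm A * frob_norm B"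
  using assms frob_norm_mult_le euclid_norm_mult_le_spectral_norm spectral_norm_nonneg by metis

lemma frob_norm_adjoint_mult_spectral_left:
  assumes "A \<in> carrier_mat q p" "B \<in> carrier_mat q s"
  shows "frob_norm (mat_adjoint A * B) \<le> spectral_norm A * frob_norm B"
  using assms frob_norm_mult_le euclid_norm_adjoint_mult_le_spectral_norm spectral_norm_nonneg
    mat_adjoint_carrier by metis

lemma frob_norm_mult_spectral_right:
  assumes A: "A \<in> carrier_mat p q" and B: "B \<in> carrier_mat q s"
  shows "frob_norm (A * B) \<le> spectral_norm B * frob_norm A"
  using frob_norm_adjoint_mult_spectral_left[OF B mat_adjoint_carrier[OF A]]
    frob_norm_adjoint[of "A * B"] frob_norm_adjoint[of A] mat_adjoint_mult[OF A B] by simp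

lemma frob_norm_mult_adjoint_spectral_right:
  assumes A: "A \<in> carrier_mat p q" and B: "B \<in> carrier_mat s q"
  shows "frob_norm (A * mat_adjoint B) \<le> spectral_norm B * frob_norm A"
  using frob_norm_mult_spectral_left[OF B mat_adjoint_carrier[OF A]]
    frob_norm_adjoint[of "A * mat_adjoint B"] frob_norm_adjoint[of A]
    mat_adjoint_mult[OF A mat_adjoint_carrier[OF B]] by simp

lemma frob_norm_unitary_left:
  assumes Q: "unitary_mat k Q" and A: "A \<in> carrier_mat k s"
  shows "frob_norm (Q * A) = frob_norm A"
proof -
  have Qc: "Q \<in> carrier_mat k k" and QQ: "mat_adjoint Q * Q = 1\<^sub>m k"
    using Q by (auto simp: unitary_mat_def)
  have iso: "euclid_norm (Q *\<^sub>v x) = euclid_norm x" if x: "x \<in> carrier_vec k" for x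
  proof -
    have Qx: "Q *\<^sub>v x \<in> carrier_vec k" using Qc x by auto
    have "mat_adjoint Q *\<^sub>v (Q *\<^sub>v x) = x"
      using assoc_mult_mat_vec[OF mat_adjoint_carrier[OF Qc] Qc x] QQ x by simp
    then have "complex_of_real ((euclid_norm (Q *\<^sub>v x))\<^sup>2) = complex_of_real ((euclid_norm x)\<^sup>2)"
      using cscalar_prod_adjoint[OF Qc x Qx] by (simp add: cscalar_prod_self)
    then show ?thesis
      by (metis of_real_eq_iff euclid_norm_nonneg power2_eq_imp_eq)
  qed
  show ?thesis
    unfolding frob_norm_cols
    by (intro L2_set_cong) (use A in \<open>auto simp: col_mult2[OF Qc A] iso simp del: col_mult\<close>)
qed

lemma unitary_mat_adjoint: "unitary_mat k Q \<Longrightarrow> unitary_mat k (mat_adjoint Q)"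
  by (simp add: unitary_mat_def)

lemma frob_norm_unitary_right:
  assumes Q: "unitary_mat k Q" and A: "A \<in> carrier_mat s k"
  shows "frob_norm (A * Q) = frob_norm A"
proof -
  have Qc: "Q \<in> carrier_mat k k" using Q by (simp add: unitary_mat_def)
  have "frob_norm (A * Q) = frob_norm (mat_adjoint Q * mat_adjoint A)"
    using mat_adjoint_mult[OF A Qc] frob_norm_adjoint by metis
  then show ?thesis
    using frob_norm_unitary_left[OF unitary_mat_adjoint[OF Q] mat_adjoint_carrier[OF A]] by simp
qed

section \<open>The spectral theorem for Hermitian matrices\<close>

lemma unitary_mat_carrier: "unitary_mat k Q \<Longrightarrow> Q \<in> carrier_mat k k"
  by (simp add: unitary_mat_def)

lemma unitary_mat_mult:
  assumes Q: "unitary_mat k Q" and R: "unitary_mat k R"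
  shows "unitary_mat k (Q * R)"
proof -
  have c: "Q \<in> carrier_mat k k" "R \<in> carrier_mat k k"
    "mat_adjoint Q \<in> carrier_mat k k" "mat_adjoint R \<in> carrier_mat k k"
    using Q R by (auto simp: unitary_mat_def)
  have "mat_adjoint R * mat_adjoint Q * (Q * R) = 1\<^sub>m k"
    unfolding assoc_mult_mat[OF c(4) c(3) mult_carrier_mat[OF c(1) c(2)]]
      assoc_mult_mat[symmetric, OF c(3) c(1) c(2)]
    using Q R by (auto simp: unitary_mat_def)
  moreover have "Q * R * (mat_adjoint R * mat_adjoint Q) = 1\<^sub>m k"
    unfolding assoc_mult_mat[OF c(1) c(2) mult_carrier_mat[OF c(4) c(3)]]
      assoc_mult_mat[symmetric, OF c(2) c(4) c(3)]
    using Q R by (auto simp: unitary_mat_def)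
  ultimately show ?thesis
    using c by (simp add: unitary_mat_def mat_adjoint_mult[OF c(1,2)])
qed

text \<open>Gram-Schmidt applied to a basis that starts with \<open>v\<close> keeps \<open>v\<close> as its first vector; it yields
orthogonal vectors that still have to be normalized.\<close>
lemma unitary_completion:
  assumes v: "v \<in> carrier_vec n" and unit: "euclid_norm v = 1"
  shows "\<exists>W. unitary_mat n W \<and> col W 0 = v"
proof -
  have v0: "v \<noteq> 0\<^sub>v n" using unit euclid_norm_eq_0[OF v] by auto
  then have n: "0 < n" using v by (cases n) auto
  interpret cof_vec_space n "TYPE(complex)" .
  define ws where "ws = gram_schmidt n (basis_completion v)"
  note b = basis_completion[OF v v0]
  have ws: "set ws \<subseteq> carrier_vec n" "corthogonal ws" "length ws = n"
    using gram_schmidt_result[OF b(2,4,5) ws_def] b(6) by auto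
  have "basis_completion v \<noteq> []" using b(6) n by auto
  then obtain vs where "basis_completion v = v # vs"
    using b(7) by (cases "basis_completion v") auto
  then have "hd ws = v" using gram_schmidt_hd[OF v] by (simp add: ws_def)
  then have ws0: "ws ! 0 = v" using ws(3) n by (cases ws) auto
  have wsc: "ws ! j \<in> carrier_vec n" if "j < n" for j using ws that by auto
  have orth: "ws ! j \<bullet>c ws ! i = 0 \<longleftrightarrow> i \<noteq> j" if "i < n" "j < n" for i j
    using corthogonalD[OF ws(2)] ws(3) that by auto
  have pos: "euclid_norm (ws ! j) \<noteq> 0" if "j < n" for j
    using orth[OF that that] by (simp add: cscalar_prod_self)
  define W where "W = mat n n (\<lambda>(i, j). ws ! j $ i / complex_of_real (euclid_norm (ws ! j)))"
  have W: "W \<in> carrier_mat n n" by (simp add: W_def)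
  have WW: "mat_adjoint W * W = 1\<^sub>m n"
  proof (rule eq_matI)
    fix i j assume "i < dim_row (1\<^sub>m n :: complex mat)" "j < dim_col (1\<^sub>m n :: complex mat)"
    then have ij: "i < n" "j < n" by auto
    have "(mat_adjoint W * W) $$ (i, j)
        = (ws ! j \<bullet>c ws ! i) / (complex_of_real (euclid_norm (ws ! i)) * complex_of_real (euclid_norm (ws ! j)))"
      using ij wsc[OF ij(1)] W
      by (simp add: W_def scalar_prod_def sum_divide_distrib mult_ac)
    also have "\<dots> = 1\<^sub>m n $$ (i, j)"
      using ij orth[OF ij] pos by (auto simp: cscalar_prod_self power2_eq_square)
    finally show "(mat_adjoint W * W) $$ (i, j) = 1\<^sub>m n $$ (i, j)" .
  qed (use W in auto)
  have "W * mat_adjoint W = 1\<^sub>m n"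
    by (rule mat_mult_left_right_inverse[OF mat_adjoint_carrier[OF W] W WW])
  moreover have "col W 0 = v"
    using n v unit by (auto intro!: eq_vecI simp: W_def ws0)
  ultimately show ?thesis using W WW by (auto simp: unitary_mat_def)
qed

definition real_diag :: "nat \<Rightarrow> (nat \<Rightarrow> real) \<Rightarrow> complex mat" where
  "real_diag k l = mat k k (\<lambda>(i, j). if i = j then complex_of_real (l i) else 0)"

lemma real_diag_carrier [simp]: "real_diag k l \<in> carrier_mat k k"
  by (simp add: real_diag_def)

lemma index_mult_real_diag:
  assumes "A \<in> carrier_mat p k" "i < p" "j < k"
  shows "(A * real_diag k l) $$ (i, j) = A $$ (i, j) * complex_of_real (l j)"
  using assms by (simp add: real_diag_def scalar_prod_def if_distrib[of "\<lambda>x. _ * x"] cong: if_cong)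

lemma index_real_diag_mult:
  assumes "A \<in> carrier_mat k q" "i < k" "j < q"
  shows "(real_diag k l * A) $$ (i, j) = complex_of_real (l i) * A $$ (i, j)"
  using assms by (simp add: real_diag_def scalar_prod_def if_distrib[of "\<lambda>x. x * _"] cong: if_cong)

lemma exists_unit_eigenvector:
  fixes H :: "complex mat"
  assumes H: "H \<in> carrier_mat (Suc k) (Suc k)"
  obtains e v where "v \<in> carrier_vec (Suc k)" "euclid_norm v = 1" "H *\<^sub>v v = e \<cdot>\<^sub>v v"
proof -
  have "degree (char_poly H) = Suc k" using degree_monic_char_poly[OF H] by simp
  then have "\<not> constant (poly (char_poly H))" by (simp add: constant_degree)
  then obtain e where "poly (char_poly H) e = 0" using fundamental_theorem_of_algebra by blast
  then obtain u where u: "u \<in> carrier_vec (Suc k)" "u \<noteq> 0\<^sub>v (Suc k)" "H *\<^sub>v u = e \<cdot>\<^sub>v u"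
    using eigenvalue_root_char_poly[OF H] H by (auto simp: eigenvalue_def eigenvector_def)
  define c where "c = complex_of_real (1 / euclid_norm u)"
  have "euclid_norm (c \<cdot>\<^sub>v u) = 1"
    using u euclid_norm_eq_0[OF u(1)] by (simp add: euclid_norm_smult c_def norm_divide)
  moreover have "H *\<^sub>v (c \<cdot>\<^sub>v u) = e \<cdot>\<^sub>v (c \<cdot>\<^sub>v u)"
    using H u by (simp add: mult_mat_vec smult_smult_assoc mult.commute)
  ultimately show ?thesis using that[of "c \<cdot>\<^sub>v u" e] u(1) by simp
qed

text \<open>Induction on the size. A unitary \<open>W\<close> whose first column is a unit eigenvector makes the first
column of \<open>W\<^sup>H H W\<close> a multiple of the first unit vector. As this matrix is Hermitian again, its first
row has the same shape and the eigenvalue is real, so that a smaller Hermitian block remains.\<close>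
theorem hermitian_diagonalization:
  fixes H :: "complex mat"
  assumes "H \<in> carrier_mat k k" "mat_adjoint H = H"
  shows "\<exists>Q l. unitary_mat k Q \<and> H * Q = Q * real_diag k l"
  using assms
proof (induction k arbitrary: H)
  case 0
  have "unitary_mat 0 (1\<^sub>m 0)" by (simp add: unitary_mat_def)
  moreover have "H * 1\<^sub>m 0 = 1\<^sub>m 0 * real_diag 0 (\<lambda>_. 0)"
    using 0 by (intro eq_matI) (auto simp: real_diag_def)
  ultimately show ?case by blast
next
  case (Suc k)
  note H = Suc.prems(1) and herm = Suc.prems(2)
  obtain e v where v: "v \<in> carrier_vec (Suc k)" "euclid_norm v = 1" "H *\<^sub>v v = e \<cdot>\<^sub>v v"
    by (rule exists_unit_eigenvector[OF H])
  obtain W where W: "unitary_mat (Suc k) W" and col: "col W 0 = v"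
    using unitary_completion[OF v(1,2)] by blast
  have Wc: "W \<in> carrier_mat (Suc k) (Suc k)" and Wa: "mat_adjoint W \<in> carrier_mat (Suc k) (Suc k)"
    and WW: "mat_adjoint W * W = 1\<^sub>m (Suc k)" "W * mat_adjoint W = 1\<^sub>m (Suc k)"
    using W by (auto simp: unitary_mat_def)
  define K where "K = mat_adjoint W * (H * W)"
  have HW: "H * W \<in> carrier_mat (Suc k) (Suc k)" using H Wc by auto
  have K: "K \<in> carrier_mat (Suc k) (Suc k)" using Wa HW by (auto simp: K_def)
  have Kherm: "mat_adjoint K = K"
    unfolding K_def mat_adjoint_mult[OF Wa HW] mat_adjoint_mult[OF H Wc] herm
    using Wc Wa H by (simp add: assoc_mult_mat[of _ "Suc k" "Suc k" _ "Suc k" _ "Suc k"])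
  have "col K 0 = mat_adjoint W *\<^sub>v (H *\<^sub>v v)"
    unfolding K_def by (simp add: col_mult2[OF Wa HW] col_mult2[OF H Wc] col del: col_mult)
  also have "\<dots> = e \<cdot>\<^sub>v (mat_adjoint W *\<^sub>v col W 0)"
    using Wa v by (simp add: mult_mat_vec col)
  also have "mat_adjoint W *\<^sub>v col W 0 = col (1\<^sub>m (Suc k)) 0"
    using col_mult2[OF Wa Wc, of 0] WW by simp
  finally have col0: "col K 0 = e \<cdot>\<^sub>v unit_vec (Suc k) 0" by simp
  have Ki0: "K $$ (i, 0) = (if i = 0 then e else 0)" if "i < Suc k" for i
    using arg_cong[OF col0, of "\<lambda>x. x $ i"] that K by (auto simp: unit_vec_def)
  have Kcnj: "K $$ (i, j) = cnj (K $$ (j, i))" if "i < Suc k" "j < Suc k" for i j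
    using index_mat_adjoint[of i K j] Kherm that K by auto
  \<comment> \<open>A diagonal entry of a Hermitian matrix is real.\<close>
  have e: "e = complex_of_real (Re e)"
    using Kcnj[of 0 0] Ki0[of 0] by (auto simp: complex_eq_iff)
  have K0j: "K $$ (0, j) = (if j = 0 then e else 0)" if "j < Suc k" for j
    using Kcnj[of 0 j] Ki0[of j] that e by (auto simp: complex_eq_iff)
  define K' where "K' = mat k k (\<lambda>(i, j). K $$ (Suc i, Suc j))"
  have K': "K' \<in> carrier_mat k k" by (simp add: K'_def)
  have "mat_adjoint K' = K'"
  proof (rule eq_matI)
    fix i j assume "i < dim_row K'" "j < dim_col K'"
    then show "mat_adjoint K' $$ (i, j) = K' $$ (i, j)"
      using Kcnj[of "Suc i" "Suc j"] by (simp add: K'_def)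
  qed (simp_all add: K'_def)
  then obtain Q' l' where Q': "unitary_mat k Q'" and diag': "K' * Q' = Q' * real_diag k l'"
    using Suc.IH[OF K'] by blast
  have Q'c: "Q' \<in> carrier_mat k k" "mat_adjoint Q' \<in> carrier_mat k k"
    using Q' by (auto simp: unitary_mat_def)
  let ?bd = "\<lambda>A B :: complex mat. four_block_mat A (0\<^sub>m 1 k) (0\<^sub>m k 1) B"
  have bd_mult: "?bd A B * ?bd C D = ?bd (A * C) (B * D)"
    if "A \<in> carrier_mat 1 1" "B \<in> carrier_mat k k" "C \<in> carrier_mat 1 1" "D \<in> carrier_mat k k" for A B C D
    using that by (subst mult_four_block_mat[OF that(1) _ _ that(2) that(3) _ _ that(4)]) auto
  have bd_one: "?bd (1\<^sub>m 1) (1\<^sub>m k) = 1\<^sub>m (Suc k)" by (intro eq_matI) auto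
  let ?E = "mat 1 1 (\<lambda>_. e)"
  define l where "l = case_nat (Re e) l'"
  have Kbd: "K = ?bd ?E K'"
    using K Ki0 K0j by (intro eq_matI) (auto simp: K'_def)
  have Dbd: "real_diag (Suc k) l = ?bd ?E (real_diag k l')"
    using e by (intro eq_matI) (auto simp: real_diag_def l_def split: nat.splits)
  define R where "R = ?bd (1\<^sub>m 1) Q'"
  have Ra: "mat_adjoint R = ?bd (1\<^sub>m 1) (mat_adjoint Q')"
    unfolding R_def using Q'c by (subst mat_adjoint_four_block) auto
  have R: "unitary_mat (Suc k) R"
    using Q' Q'c unfolding unitary_mat_def Ra by (auto simp: R_def bd_mult bd_one simp del: One_nat_def)
  have Rc: "R \<in> carrier_mat (Suc k) (Suc k)" using R by (rule unitary_mat_carrier)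
  have KR: "K * R = R * real_diag (Suc k) l"
    unfolding Kbd Dbd R_def using K' Q'c diag' by (simp add: bd_mult del: One_nat_def)
  have "H * (W * R) = W * (K * R)"
  proof -
    have "W * K = (W * mat_adjoint W) * (H * W)"
      unfolding K_def using assoc_mult_mat[OF Wc Wa HW] by simp
    then have "W * K = H * W" using WW left_mult_one_mat[OF HW] by simp
    then show ?thesis
      using assoc_mult_mat[OF Wc K Rc] assoc_mult_mat[OF H Wc Rc] by simp
  qed
  also have "\<dots> = (W * R) * real_diag (Suc k) l"
    unfolding KR by (rule assoc_mult_mat[symmetric, OF Wc Rc real_diag_carrier])
  finally show ?case using unitary_mat_mult[OF W R] by blast
qed

section \<open>Sylvester operators with Hermitian coefficients\<close>

text \<open>Associativity with premises on dimensions instead of carriers: the simplifier can discharge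
these, whereas the carrier premises contain an index that matching does not determine.\<close>
lemma mult_assoc_dim:
  fixes A B C :: "complex mat"
  assumes "dim_col A = dim_row B" "dim_col B = dim_row C"
  shows "A * B * C = A * (B * C)"
  by (rule assoc_mult_mat[of _ "dim_row A" "dim_row B" _ "dim_row C" _ "dim_col C"]) (use assms in auto)

lemma frob_norm_mono:
  assumes "A \<in> carrier_mat p q" "B \<in> carrier_mat p q" "0 \<le> c"
    and "\<And>i j. i < p \<Longrightarrow> j < q \<Longrightarrow> c * cmod (A $$ (i, j)) \<le> cmod (B $$ (i, j))"
  shows "c * frob_norm A \<le> frob_norm B"
  unfolding frob_norm_L2_set using assms by (auto simp: L2_set_right_distrib intro!: L2_set_mono)

lemma unitary_cancel:
  assumes Q: "unitary_mat k Q" and X: "dim_row X = k"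
  shows "mat_adjoint Q * (Q * X) = X" "Q * (mat_adjoint Q * X) = X"
proof -
  have c: "Q \<in> carrier_mat k k" "mat_adjoint Q \<in> carrier_mat k k" "X \<in> carrier_mat k (dim_col X)"
    using Q X by (auto simp: unitary_mat_def)
  show "mat_adjoint Q * (Q * X) = X" "Q * (mat_adjoint Q * X) = X"
    using Q c(3) assoc_mult_mat[symmetric, OF c(2,1,3)] assoc_mult_mat[symmetric, OF c(1,2,3)]
    by (auto simp: unitary_mat_def)
qed

text \<open>From \<open>H = Q D Q\<^sup>H\<close>: the adjoint of an eigenvector column of \<open>Q\<close> is a left eigenvector.\<close>
lemma diagonalized_left:
  assumes H: "H \<in> carrier_mat k k" and Q: "unitary_mat k Q" and diag: "H * Q = Q * real_diag k l"
  shows "mat_adjoint Q * H = real_diag k l * mat_adjoint Q"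
proof -
  have Qc: "Q \<in> carrier_mat k k" and QQ: "Q * mat_adjoint Q = 1\<^sub>m k"
    using Q by (auto simp: unitary_mat_def)
  have dims: "dim_row Q = k" "dim_col Q = k" "dim_row H = k" "dim_col H = k"
    "dim_row (real_diag k l) = k" "dim_col (real_diag k l) = k"
    using Qc H by (auto simp: real_diag_def)
  have "mat_adjoint Q * H = mat_adjoint Q * (H * (Q * mat_adjoint Q))"
    using H QQ by simp
  also have "\<dots> = mat_adjoint Q * ((H * Q) * mat_adjoint Q)"
    by (simp add: mult_assoc_dim dims)
  also have "\<dots> = real_diag k l * mat_adjoint Q"
    unfolding diag by (simp add: mult_assoc_dim dims unitary_cancel[OF Q])
  finally show ?thesis .
qed

text \<open>In the eigenbases of \<open>H1\<close> and \<open>H2\<close> the Sylvester operator \<open>Y \<mapsto> Y H1 - H2 Y\<close> multiplies each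
entry separately, with the differences of the eigenvalues as factors.\<close>
lemma sylvester_diagonal_coordinates:
  assumes H1: "H1 \<in> carrier_mat k1 k1" and Q1: "unitary_mat k1 Q1" and diag1: "H1 * Q1 = Q1 * real_diag k1 l1"
    and H2: "H2 \<in> carrier_mat k2 k2" and Q2: "unitary_mat k2 Q2" and diag2: "H2 * Q2 = Q2 * real_diag k2 l2"
    and Y: "Y \<in> carrier_mat k2 k1" and ij: "i < k2" "j < k1"
  shows "(mat_adjoint Q2 * (Y * H1 - H2 * Y) * Q1) $$ (i, j)
    = (mat_adjoint Q2 * Y * Q1) $$ (i, j) * complex_of_real (l1 j - l2 i)"
proof -
  have c: "Q1 \<in> carrier_mat k1 k1" "mat_adjoint Q2 \<in> carrier_mat k2 k2"
    using Q1 Q2 by (auto simp: unitary_mat_def)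
  have dims: "dim_row Q1 = k1" "dim_col Q1 = k1" "dim_row Q2 = k2" "dim_col Q2 = k2"
    "dim_row H1 = k1" "dim_col H1 = k1" "dim_row H2 = k2" "dim_col H2 = k2" "dim_row Y = k2" "dim_col Y = k1"
    "dim_row (real_diag k l) = k" "dim_col (real_diag k l) = k" for k l
    using c H1 H2 Y by (auto simp: real_diag_def)
  let ?Y = "mat_adjoint Q2 * Y * Q1"
  have Yc: "?Y \<in> carrier_mat k2 k1" using c Y by auto
  have 1: "mat_adjoint Q2 * (Y * H1) * Q1 = ?Y * real_diag k1 l1"
    by (simp add: mult_assoc_dim dims diag1)
  have "mat_adjoint Q2 * (H2 * Y) * Q1 = (mat_adjoint Q2 * H2) * (Y * Q1)"
    by (simp add: mult_assoc_dim dims)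
  also have "\<dots> = real_diag k2 l2 * ?Y"
    unfolding diagonalized_left[OF H2 Q2 diag2] by (simp add: mult_assoc_dim dims)
  finally have 2: "mat_adjoint Q2 * (H2 * Y) * Q1 = real_diag k2 l2 * ?Y" .
  have YH: "Y * H1 \<in> carrier_mat k2 k1" "H2 * Y \<in> carrier_mat k2 k1"
    using Y H1 H2 by auto
  have "mat_adjoint Q2 * (Y * H1 - H2 * Y) * Q1
      = mat_adjoint Q2 * (Y * H1) * Q1 - mat_adjoint Q2 * (H2 * Y) * Q1"
    using mult_minus_distrib_mat[OF c(2) YH]
      minus_mult_distrib_mat[OF mult_carrier_mat[OF c(2) YH(1)] mult_carrier_mat[OF c(2) YH(2)] c(1)]
    by simp
  also have "\<dots> = ?Y * real_diag k1 l1 - real_diag k2 l2 * ?Y"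
    unfolding 1 2 ..
  finally show ?thesis
    using ij index_mult_real_diag[OF Yc ij] index_real_diag_mult[OF Yc ij]
    by (simp add: dims algebra_simps)
qed

lemma frob_norm_diagonal_coordinates:
  assumes "unitary_mat k1 Q1" "unitary_mat k2 Q2" "Y \<in> carrier_mat k2 k1"
  shows "frob_norm (mat_adjoint Q2 * Y * Q1) = frob_norm Y"
proof -
  have "mat_adjoint Q2 * Y \<in> carrier_mat k2 k1"
    using unitary_mat_carrier[OF unitary_mat_adjoint[OF assms(2)]] assms(3) by auto
  then show ?thesis
    using frob_norm_unitary_right frob_norm_unitary_left[OF unitary_mat_adjoint] assms by metis
qed

text \<open>The change to eigenbases is unitary, hence a Frobenius isometry; in the new coordinates the bound
holds entry by entry.\<close>
lemma sylvester_lower_bound: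
  assumes H1: "H1 \<in> carrier_mat k1 k1" and Q1: "unitary_mat k1 Q1" and diag1: "H1 * Q1 = Q1 * real_diag k1 l1"
    and H2: "H2 \<in> carrier_mat k2 k2" and Q2: "unitary_mat k2 Q2" and diag2: "H2 * Q2 = Q2 * real_diag k2 l2"
    and Y: "Y \<in> carrier_mat k2 k1" and c: "0 \<le> c"
    and gap: "\<And>i j. i < k2 \<Longrightarrow> j < k1 \<Longrightarrow> c \<le> \<bar>l1 j - l2 i\<bar>"
  shows "c * frob_norm Y \<le> frob_norm (Y * H1 - H2 * Y)"
proof -
  have Qc: "Q1 \<in> carrier_mat k1 k1" "mat_adjoint Q2 \<in> carrier_mat k2 k2"
    using Q1 Q2 by (auto simp: unitary_mat_def)
  have Sc: "Y * H1 - H2 * Y \<in> carrier_mat k2 k1" using Y H1 H2 by auto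
  have "c * frob_norm (mat_adjoint Q2 * Y * Q1) \<le> frob_norm (mat_adjoint Q2 * (Y * H1 - H2 * Y) * Q1)"
  proof (rule frob_norm_mono[of _ k2 k1])
    fix i j assume ij: "i < k2" "j < k1"
    show "c * cmod ((mat_adjoint Q2 * Y * Q1) $$ (i, j))
        \<le> cmod ((mat_adjoint Q2 * (Y * H1 - H2 * Y) * Q1) $$ (i, j))"
      unfolding sylvester_diagonal_coordinates[OF H1 Q1 diag1 H2 Q2 diag2 Y ij] norm_mult norm_of_real
      by (subst (2) mult.commute) (intro mult_right_mono gap ij norm_ge_zero)
  qed (use Qc Y Sc c in auto)
  then show ?thesis
    by (simp only: frob_norm_diagonal_coordinates[OF Q1 Q2 Y] frob_norm_diagonal_coordinates[OF Q1 Q2 Sc])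
qed

lemma sylvester_solvable:
  assumes H1: "H1 \<in> carrier_mat k1 k1" and Q1: "unitary_mat k1 Q1" and diag1: "H1 * Q1 = Q1 * real_diag k1 l1"
    and H2: "H2 \<in> carrier_mat k2 k2" and Q2: "unitary_mat k2 Q2" and diag2: "H2 * Q2 = Q2 * real_diag k2 l2"
    and C: "C \<in> carrier_mat k2 k1"
    and disjoint: "\<And>i j. i < k2 \<Longrightarrow> j < k1 \<Longrightarrow> l1 j \<noteq> l2 i"
  shows "\<exists>Y \<in> carrier_mat k2 k1. Y * H1 - H2 * Y = C"
proof -
  have c: "Q1 \<in> carrier_mat k1 k1" "mat_adjoint Q1 \<in> carrier_mat k1 k1"
    "Q2 \<in> carrier_mat k2 k2" "mat_adjoint Q2 \<in> carrier_mat k2 k2"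
    "mat_adjoint Q1 * Q1 = 1\<^sub>m k1" "Q1 * mat_adjoint Q1 = 1\<^sub>m k1"
    using Q1 Q2 by (auto simp: unitary_mat_def)
  have dims: "dim_row Q1 = k1" "dim_col Q1 = k1" "dim_row Q2 = k2" "dim_col Q2 = k2"
    using c by auto
  define C' where "C' = mat_adjoint Q2 * C * Q1"
  define Y' where "Y' = mat k2 k1 (\<lambda>(i, j). C' $$ (i, j) / complex_of_real (l1 j - l2 i))"
  define Y where "Y = Q2 * Y' * mat_adjoint Q1"
  have Y'c: "Y' \<in> carrier_mat k2 k1" by (simp add: Y'_def)
  have C'c: "C' \<in> carrier_mat k2 k1" using c C by (auto simp: C'_def)
  have Y: "Y \<in> carrier_mat k2 k1" using c Y'c by (auto simp: Y_def)
  have Sc: "Y * H1 - H2 * Y \<in> carrier_mat k2 k1" using Y H1 H2 by auto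
  have recover: "Q2 * (mat_adjoint Q2 * X * Q1) * mat_adjoint Q1 = X" if "X \<in> carrier_mat k2 k1" for X
    using that c by (simp add: mult_assoc_dim dims unitary_cancel[OF Q2])
  have Y': "mat_adjoint Q2 * Y * Q1 = Y'"
    unfolding Y_def using Y'c c by (simp add: mult_assoc_dim dims unitary_cancel[OF Q2])
  have "mat_adjoint Q2 * (Y * H1 - H2 * Y) * Q1 = C'"
  proof (rule eq_matI)
    fix i j assume "i < dim_row C'" "j < dim_col C'"
    then have ij: "i < k2" "j < k1" using C'c by auto
    then show "(mat_adjoint Q2 * (Y * H1 - H2 * Y) * Q1) $$ (i, j) = C' $$ (i, j)"
      unfolding sylvester_diagonal_coordinates[OF H1 Q1 diag1 H2 Q2 diag2 Y ij] Y'
      using disjoint[OF ij] by (simp add: Y'_def)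
  qed (use c C'c Sc in auto)
  then have "Y * H1 - H2 * Y = Q2 * C' * mat_adjoint Q1"
    using recover[OF Sc] by simp
  also have "\<dots> = C"
    unfolding C'_def by (rule recover[OF C])
  finally show ?thesis using Y by blast
qed

lemma diagonalized_trivial:
  "unitary_mat k (1\<^sub>m k)" "0\<^sub>m k k * 1\<^sub>m k = 1\<^sub>m k * real_diag k (\<lambda>_. 0)"
  by (auto simp: unitary_mat_def real_diag_def intro!: eq_matI)

text \<open>This is the Sylvester bound with the zero matrix in place of \<open>H2\<close>.\<close>
lemma frob_norm_mult_diagonalized_ge:
  assumes H: "H \<in> carrier_mat k k" and Q: "unitary_mat k Q" and diag: "H * Q = Q * real_diag k l"
    and Y: "Y \<in> carrier_mat p k" and c: "0 \<le> c" and le: "\<And>i. i < k \<Longrightarrow> c \<le> \<bar>l i\<bar>"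
  shows "c * frob_norm Y \<le> frob_norm (Y * H)"
proof -
  have "Y * H - 0\<^sub>m p p * Y = Y * H"
    using Y H by (intro eq_matI) auto
  then show ?thesis
    using sylvester_lower_bound[OF H Q diag zero_carrier_mat diagonalized_trivial Y c] le by simp
qed

lemma frob_norm_diagonalized_mult_le:
  assumes H: "H \<in> carrier_mat k k" and Q: "unitary_mat k Q" and diag: "H * Q = Q * real_diag k l"
    and Y: "Y \<in> carrier_mat k p" and c: "0 \<le> c" and le: "\<And>i. i < k \<Longrightarrow> \<bar>l i\<bar> \<le> c"
  shows "frob_norm (H * Y) \<le> c * frob_norm Y"
proof -
  have Qa: "unitary_mat k (mat_adjoint Q)" and Qac: "mat_adjoint Q \<in> carrier_mat k k"
    using Q by (auto simp: unitary_mat_def)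
  have dims: "dim_row Q = k" "dim_col Q = k" "dim_row H = k" "dim_col H = k" "dim_row Y = k" "dim_col Y = p"
    "dim_row (real_diag k l) = k" "dim_col (real_diag k l) = k"
    using Q H Y by (auto simp: unitary_mat_def real_diag_def)
  have QY: "mat_adjoint Q * Y \<in> carrier_mat k p" using Qac Y by auto
  have "mat_adjoint Q * (H * Y) = (mat_adjoint Q * H) * Y"
    by (simp add: mult_assoc_dim dims)
  also have "\<dots> = real_diag k l * (mat_adjoint Q * Y)"
    unfolding diagonalized_left[OF H Q diag] by (simp add: mult_assoc_dim dims)
  finally have eq: "mat_adjoint Q * (H * Y) = real_diag k l * (mat_adjoint Q * Y)" .
  have "frob_norm (H * Y) = frob_norm (real_diag k l * (mat_adjoint Q * Y))"
    using frob_norm_unitary_left[OF Qa, of "H * Y" p] H Y eq by simp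
  also have "\<dots> = L2_set (\<lambda>ij. cmod ((real_diag k l * (mat_adjoint Q * Y)) $$ ij)) ({..<k} \<times> {..<p})"
    unfolding frob_norm_L2_set using QY by (simp add: dims)
  also have "\<dots> \<le> L2_set (\<lambda>ij. c * cmod ((mat_adjoint Q * Y) $$ ij)) ({..<k} \<times> {..<p})"
  proof (rule L2_set_mono)
    fix ij assume "ij \<in> {..<k} \<times> {..<p}"
    then obtain i j where ij: "ij = (i, j)" "i < k" "j < p" by auto
    show "cmod ((real_diag k l * (mat_adjoint Q * Y)) $$ ij) \<le> c * cmod ((mat_adjoint Q * Y) $$ ij)"
      unfolding ij(1) index_real_diag_mult[OF QY ij(2,3)] norm_mult norm_of_real
      by (intro mult_right_mono le ij) auto
  qed simp
  also have "\<dots> = c * frob_norm (mat_adjoint Q * Y)"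
    unfolding frob_norm_L2_set using c by (simp add: L2_set_right_distrib dims)
  also have "frob_norm (mat_adjoint Q * Y) = frob_norm Y"
    by (rule frob_norm_unitary_left[OF Qa Y])
  finally show ?thesis .
qed

section \<open>Singular values and Hermitian dilations\<close>

lemma in_sv_tall:
  assumes B: "B \<in> carrier_mat p q" and le: "q \<le> p"
    and w: "w \<in> carrier_vec q" "w \<noteq> 0\<^sub>v q"
    and ev: "mat_adjoint B *\<^sub>v (B *\<^sub>v w) = complex_of_real (t\<^sup>2) \<cdot>\<^sub>v w"
  shows "\<bar>t\<bar> \<in># sv B"
proof -
  let ?M = "mat_adjoint B * B"
  have M: "?M \<in> carrier_mat q q" using mult_carrier_mat[OF mat_adjoint_carrier[OF B] B] .
  have "?M *\<^sub>v w = complex_of_real (t\<^sup>2) \<cdot>\<^sub>v w"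
    using assoc_mult_mat_vec[OF mat_adjoint_carrier[OF B] B w(1)] ev by simp
  then have "eigenvalue ?M (complex_of_real (t\<^sup>2))"
    using B w by (auto simp: eigenvalue_def eigenvector_def)
  moreover have "char_poly ?M \<noteq> 0" using degree_monic_char_poly[OF M] by auto
  ultimately have "complex_of_real (t\<^sup>2) \<in># proots (char_poly ?M)"
    using eigenvalue_root_char_poly[OF M] by simp
  then have "sqrt (Re (complex_of_real (t\<^sup>2))) \<in># sv B"
    using B le unfolding sv_def
    by (auto intro!: image_eqI[of _ _ "complex_of_real (t\<^sup>2)"] simp del: of_real_power)
  then show ?thesis by simp
qed

text \<open>For a matrix with fewer rows than columns the smaller Gram matrix is the one of its adjoint.\<close>
lemma in_sv_wide:
  assumes B: "B \<in> carrier_mat p q" and less: "p < q"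
    and u: "u \<in> carrier_vec p" "u \<noteq> 0\<^sub>v p"
    and ev: "B *\<^sub>v (mat_adjoint B *\<^sub>v u) = complex_of_real (t\<^sup>2) \<cdot>\<^sub>v u"
  shows "\<bar>t\<bar> \<in># sv B"
proof -
  have "\<bar>t\<bar> \<in># sv (mat_adjoint B)"
    using in_sv_tall[OF mat_adjoint_carrier[OF B] less_imp_le[OF less] u] ev by simp
  then show ?thesis using B less by (simp add: sv_def)
qed

text \<open>An eigenvalue \<open>z\<close> of \<open>A\<^sup>H A\<close> with eigenvector \<open>v\<close> satisfies \<open>\<parallel>A v\<parallel>\<^sup>2 = Re z \<parallel>v\<parallel>\<^sup>2\<close>. This has to be
shown because the real square root of a negative number is negative, not undefined.\<close>
lemma sv_nonneg:
  assumes "\<nu> \<in># sv B"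
  shows "0 \<le> \<nu>"
proof -
  have psd: "0 \<le> Re z" if z: "eigenvalue (mat_adjoint A * A) z" for A :: "complex mat" and z
  proof -
    let ?q = "dim_col A"
    have A: "A \<in> carrier_mat (dim_row A) ?q" by auto
    note Aa = mat_adjoint_carrier[OF A]
    obtain v where v: "v \<in> carrier_vec ?q" "v \<noteq> 0\<^sub>v ?q" "(mat_adjoint A * A) *\<^sub>v v = z \<cdot>\<^sub>v v"
      using z by (auto simp: eigenvalue_def eigenvector_def)
    have Av: "A *\<^sub>v v \<in> carrier_vec (dim_row A)" using A v(1) by (rule mult_mat_vec_carrier)
    have "complex_of_real ((euclid_norm (A *\<^sub>v v))\<^sup>2) = v \<bullet>c (z \<cdot>\<^sub>v v)"
      using cscalar_prod_adjoint[OF A v(1) Av] assoc_mult_mat_vec[OF Aa A v(1)] v(3)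
      by (simp add: cscalar_prod_self)
    also have "\<dots> = cnj z * complex_of_real ((euclid_norm v)\<^sup>2)"
      using v(1) cscalar_prod_self[of v] by (simp add: conjugate_smult_vec)
    finally have "Re (complex_of_real ((euclid_norm (A *\<^sub>v v))\<^sup>2)) = Re (cnj z * complex_of_real ((euclid_norm v)\<^sup>2))"
      by (rule arg_cong)
    then have "(euclid_norm (A *\<^sub>v v))\<^sup>2 = Re z * (euclid_norm v)\<^sup>2"
      by (simp del: of_real_power)
    then have "0 \<le> Re z * (euclid_norm v)\<^sup>2" by (metis zero_le_power2)
    then show ?thesis using euclid_norm_eq_0[OF v(1)] v(2) by (simp add: zero_le_mult_iff)
  qed
  define A where "A = (if dim_col B \<le> dim_row B then B else mat_adjoint B)"
  have "\<nu> \<in># image_mset (\<lambda>z. sqrt (Re z)) (proots (char_poly (mat_adjoint A * A)))"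
    using assms by (auto simp: sv_def A_def split: if_splits)
  then obtain z where z: "z \<in># proots (char_poly (mat_adjoint A * A))" "\<nu> = sqrt (Re z)" by auto
  have M: "mat_adjoint A * A \<in> carrier_mat (dim_col A) (dim_col A)" by auto
  have "char_poly (mat_adjoint A * A) \<noteq> 0" using degree_monic_char_poly[OF M] by auto
  then have "eigenvalue (mat_adjoint A * A) z"
    using z(1) eigenvalue_root_char_poly[OF M] by simp
  then show ?thesis using psd z(2) by simp
qed

lemma sigma_max_props:
  assumes "0 < min (dim_row B) (dim_col B)"
  shows "sigma_max B \<in># sv B" "\<nu> \<in># sv B \<Longrightarrow> \<nu> \<le> sigma_max B"
proof -
  let ?xs = "sorted_list_of_multiset (sv B)"
  have len: "length ?xs = min (dim_row B) (dim_col B)"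
    by (metis mset_sorted_list_of_multiset size_mset size_sv)
  then have ne: "?xs \<noteq> []" using assms by auto
  have eq: "sigma_max B = ?xs ! (length ?xs - 1)"
    using ne by (simp add: sigma_max_def singular_values_def rev_nth)
  show "sigma_max B \<in># sv B"
    unfolding eq using ne nth_mem[of "length ?xs - 1" ?xs] by simp
  show "\<nu> \<le> sigma_max B" if "\<nu> \<in># sv B"
  proof -
    have "\<nu> \<in> set ?xs" using that by simp
    then obtain i where i: "i < length ?xs" "?xs ! i = \<nu>" unfolding in_set_conv_nth by blast
    show ?thesis
      unfolding eq i(2)[symmetric] by (rule sorted_nth_mono) (use i(1) in auto)
  qed
qed

lemma sigma_min_props:
  assumes "0 < min (dim_row B) (dim_col B)"
  shows "sigma_min B \<in># sv B" "\<mu> \<in># sv B \<Longrightarrow> sigma_min B \<le> \<mu>"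
proof -
  let ?xs = "sorted_list_of_multiset (sv B)"
  have len: "length ?xs = min (dim_row B) (dim_col B)"
    by (metis mset_sorted_list_of_multiset size_mset size_sv)
  have eq: "sigma_min B = ?xs ! 0"
    using assms by (simp add: sigma_min_def singular_values_def rev_nth flip: len)
  show "sigma_min B \<in># sv B"
    unfolding eq using assms len nth_mem[of 0 ?xs] by simp
  show "sigma_min B \<le> \<mu>" if "\<mu> \<in># sv B"
  proof -
    have "\<mu> \<in> set ?xs" using that by simp
    then obtain i where i: "i < length ?xs" "?xs ! i = \<mu>" unfolding in_set_conv_nth by blast
    show ?thesis
      unfolding eq i(2)[symmetric] by (rule sorted_nth_mono) (use i(1) in auto)
  qed
qed

text \<open>The Jordan-Wielandt matrix of \<open>G\<close>. Its eigenvalues are the singular values of \<open>G\<close> with both signs,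
together with as many zeros as make up the size.\<close>
definition herm_dilation :: "complex mat \<Rightarrow> complex mat" where
  "herm_dilation G = four_block_mat (0\<^sub>m (dim_row G) (dim_row G)) G
     (mat_adjoint G) (0\<^sub>m (dim_col G) (dim_col G))"

lemma herm_dilation_carrier:
  "G \<in> carrier_mat p q \<Longrightarrow> herm_dilation G \<in> carrier_mat (p + q) (p + q)"
  by (auto simp: herm_dilation_def)

lemma mat_adjoint_herm_dilation: "mat_adjoint (herm_dilation G) = herm_dilation G"
  unfolding herm_dilation_def
  by (subst mat_adjoint_four_block[of _ "dim_row G" "dim_row G" _ "dim_col G" _ "dim_col G"]) auto

text \<open>An eigenvector splits into \<open>u\<close> and \<open>w\<close> with \<open>G w = t u\<close> and \<open>G\<^sup>H u = t w\<close>, so \<open>w\<close> and \<open>u\<close> are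
eigenvectors of the two Gram matrices for \<open>t\<^sup>2\<close>, unless they vanish. For \<open>t \<noteq> 0\<close> neither does. For
\<open>t = 0\<close> the value \<open>0\<close> is one of the additional zeros if \<open>G\<close> is not square; a square \<open>G\<close> is singular,
since \<open>G\<close> or \<open>G\<^sup>H\<close> has a nontrivial kernel.\<close>
lemma abs_dilation_eigenvalue_in_sv_ext:
  assumes G: "G \<in> carrier_mat p q" and x: "x \<in> carrier_vec (p + q)" "x \<noteq> 0\<^sub>v (p + q)"
    and ev: "herm_dilation G *\<^sub>v x = complex_of_real t \<cdot>\<^sub>v x"
  shows "\<bar>t\<bar> \<in># sv_ext G"
proof -
  have Ga: "mat_adjoint G \<in> carrier_mat q p" using G by simp
  define u where "u = vec_first x p"
  define w where "w = vec_last x q"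
  have u: "u \<in> carrier_vec p" and w: "w \<in> carrier_vec q" by (simp_all add: u_def w_def)
  have x_eq: "x = u @\<^sub>v w" using vec_first_last_append[OF x(1)] by (simp add: u_def w_def)
  have "herm_dilation G *\<^sub>v x = (0\<^sub>m p p *\<^sub>v u + G *\<^sub>v w) @\<^sub>v (mat_adjoint G *\<^sub>v u + 0\<^sub>m q q *\<^sub>v w)"
    unfolding x_eq herm_dilation_def using G Ga u w
    by (subst four_block_mat_mult_vec[of _ p p _ q _ q]) auto
  also have "\<dots> = (G *\<^sub>v w) @\<^sub>v (mat_adjoint G *\<^sub>v u)"
    using G Ga u w by auto
  finally have "complex_of_real t \<cdot>\<^sub>v x = (G *\<^sub>v w) @\<^sub>v (mat_adjoint G *\<^sub>v u)"
    unfolding ev .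
  moreover have "complex_of_real t \<cdot>\<^sub>v x = (complex_of_real t \<cdot>\<^sub>v u) @\<^sub>v (complex_of_real t \<cdot>\<^sub>v w)"
    unfolding x_eq by (rule eq_vecI) auto
  ultimately have "(G *\<^sub>v w) @\<^sub>v (mat_adjoint G *\<^sub>v u) = (complex_of_real t \<cdot>\<^sub>v u) @\<^sub>v (complex_of_real t \<cdot>\<^sub>v w)"
    by simp
  then have Gw: "G *\<^sub>v w = complex_of_real t \<cdot>\<^sub>v u"
    and Gu: "mat_adjoint G *\<^sub>v u = complex_of_real t \<cdot>\<^sub>v w"
    using append_vec_eq[of "G *\<^sub>v w" p "complex_of_real t \<cdot>\<^sub>v u"] mult_mat_vec_carrier[OF G w] u
    by auto
  have uw: "u \<noteq> 0\<^sub>v p \<or> w \<noteq> 0\<^sub>v q"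
  proof (rule ccontr)
    assume "\<not> (u \<noteq> 0\<^sub>v p \<or> w \<noteq> 0\<^sub>v q)"
    then have "x = 0\<^sub>v p @\<^sub>v 0\<^sub>v q" using x_eq by simp
    also have "\<dots> = 0\<^sub>v (p + q)" by (rule eq_vecI) auto
    finally show False using x(2) by simp
  qed
  have GGw: "mat_adjoint G *\<^sub>v (G *\<^sub>v w) = complex_of_real (t\<^sup>2) \<cdot>\<^sub>v w"
    unfolding Gw using Ga u Gu by (simp add: mult_mat_vec smult_smult_assoc power2_eq_square)
  have GGu: "G *\<^sub>v (mat_adjoint G *\<^sub>v u) = complex_of_real (t\<^sup>2) \<cdot>\<^sub>v u"
    unfolding Gu using G w Gw by (simp add: mult_mat_vec smult_smult_assoc power2_eq_square)
  have zero: "G *\<^sub>v 0\<^sub>v q = 0\<^sub>v p" "mat_adjoint G *\<^sub>v 0\<^sub>v p = 0\<^sub>v q"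
    using G by (auto intro!: eq_vecI)
  have smult_0: "v = 0\<^sub>v k" if "0\<^sub>v k = complex_of_real t \<cdot>\<^sub>v v" "t \<noteq> 0" "v \<in> carrier_vec k" for v k
  proof (rule eq_vecI)
    fix i assume "i < dim_vec (0\<^sub>v k :: complex vec)"
    then have i: "i < k" by simp
    then have "0 = (complex_of_real t \<cdot>\<^sub>v v) $ i"
      unfolding that(1)[symmetric] by simp
    then show "v $ i = 0\<^sub>v k $ i"
      using i that(2,3) by simp
  qed (use that(3) in simp)
  consider "t \<noteq> 0" | "t = 0" "p \<noteq> q" | "t = 0" "p = q" by blast
  then show ?thesis
  proof cases
    case 1
    have "w = 0\<^sub>v q" if "u = 0\<^sub>v p"
      using smult_0[OF _ 1 w] Gu zero(2) that by metis
    then have "u \<noteq> 0\<^sub>v p" using uw by blast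
    moreover have "u = 0\<^sub>v p" if "w = 0\<^sub>v q"
      using smult_0[OF _ 1 u] Gw zero(1) that by metis
    then have "w \<noteq> 0\<^sub>v q" using uw by blast
    ultimately have "\<bar>t\<bar> \<in># sv G"
      using in_sv_tall[OF G _ w _ GGw] in_sv_wide[OF G _ u _ GGu] by (cases "q \<le> p") auto
    then show ?thesis by (simp add: sv_ext_def)
  next
    case 2
    then show ?thesis using G by (auto simp: sv_ext_def)
  next
    case 3
    have sq: "G \<in> carrier_mat q q" "mat_adjoint G \<in> carrier_mat q q" using G Ga 3 by auto
    have null: "complex_of_real (t\<^sup>2) \<cdot>\<^sub>v v = 0\<^sub>v q" if "v \<in> carrier_vec q" for v
      using that 3(1) by (intro eq_vecI) auto
    obtain v where v: "v \<in> carrier_vec q" "v \<noteq> 0\<^sub>v q" "mat_adjoint G *\<^sub>v (G *\<^sub>v v) = 0\<^sub>v q"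
    proof (cases "w = 0\<^sub>v q")
      case False
      show ?thesis using that[OF w False] GGw null[OF w] by simp
    next
      case True
      have "mat_adjoint G *\<^sub>v u = 0\<^sub>v q" unfolding Gu using 3(1) w by (intro eq_vecI) auto
      moreover have "u \<in> carrier_vec q" "u \<noteq> 0\<^sub>v q" using u uw True 3(2) by auto
      ultimately have "det (mat_adjoint G) = 0"
        using det_0_iff_vec_prod_zero[OF sq(2)] by blast
      then have "det (mat_adjoint G * G) = 0" using det_mult[OF sq(2,1)] by simp
      then obtain v where v: "v \<in> carrier_vec q" "v \<noteq> 0\<^sub>v q" "(mat_adjoint G * G) *\<^sub>v v = 0\<^sub>v q"
        using det_0_iff_vec_prod_zero[OF mult_carrier_mat[OF sq(2,1)]] by blast
      show ?thesis
        using that[OF v(1,2)] v(3) unfolding assoc_mult_mat_vec[OF sq(2,1) v(1)] by blast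
    qed
    have "\<bar>t\<bar> \<in># sv G"
      using in_sv_tall[OF sq(1) order_refl v(1,2)] v(3) null[OF v(1)] by simp
    then show ?thesis by (simp add: sv_ext_def)
  qed
qed

lemma herm_dilation_diagonalization:
  assumes G: "G \<in> carrier_mat p q"
  shows "\<exists>Q l. unitary_mat (p + q) Q \<and> herm_dilation G * Q = Q * real_diag (p + q) l
    \<and> (\<forall>i < p + q. \<bar>l i\<bar> \<in># sv_ext G)"
proof -
  let ?H = "herm_dilation G" and ?k = "p + q"
  note H = herm_dilation_carrier[OF G]
  obtain Q l where Q: "unitary_mat ?k Q" and diag: "?H * Q = Q * real_diag ?k l"
    using hermitian_diagonalization[OF H mat_adjoint_herm_dilation] by blast
  have Qc: "Q \<in> carrier_mat ?k ?k" "mat_adjoint Q \<in> carrier_mat ?k ?k" "mat_adjoint Q * Q = 1\<^sub>m ?k"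
    using Q by (auto simp: unitary_mat_def)
  have "\<bar>l i\<bar> \<in># sv_ext G" if i: "i < ?k" for i
  proof (rule abs_dilation_eigenvalue_in_sv_ext[OF G])
    show "col Q i \<in> carrier_vec ?k" using col_dim[of Q i] carrier_matD(1)[OF Qc(1)] by simp
    have "mat_adjoint Q *\<^sub>v col Q i = unit_vec ?k i"
      using col_mult2[OF Qc(2,1) i] Qc(3) i by simp
    moreover have "mat_adjoint Q *\<^sub>v 0\<^sub>v ?k = 0\<^sub>v ?k" using Qc by (auto intro!: eq_vecI)
    ultimately show "col Q i \<noteq> 0\<^sub>v ?k" using i by (metis index_unit_vec(1) index_zero_vec(1) zero_neq_one)
    have "?H *\<^sub>v col Q i = col (Q * real_diag ?k l) i"
      using col_mult2[OF H Qc(1) i] diag by simp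
    also have "\<dots> = complex_of_real (l i) \<cdot>\<^sub>v col Q i"
    proof (rule eq_vecI)
      fix j assume "j < dim_vec (complex_of_real (l i) \<cdot>\<^sub>v col Q i)"
      then have j: "j < ?k" using Qc(1) by simp
      have "col (Q * real_diag ?k l) i $ j = (Q * real_diag ?k l) $$ (j, i)"
        using i j Qc(1) by (intro index_col) (auto simp: real_diag_def)
      then show "col (Q * real_diag ?k l) i $ j = (complex_of_real (l i) \<cdot>\<^sub>v col Q i) $ j"
        using index_mult_real_diag[OF Qc(1) j i] i j Qc(1) by simp
    qed (use Qc in simp)
    finally show "?H *\<^sub>v col Q i = complex_of_real (l i) \<cdot>\<^sub>v col Q i" .
  qed
  with Q diag show ?thesis by blast
qed

lemma block_diag_mult_herm_dilation:
  assumes "X \<in> carrier_mat p r" "Z \<in> carrier_mat q r" "G \<in> carrier_mat r r"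
  shows "four_block_mat X (0\<^sub>m p r) (0\<^sub>m q r) Z * herm_dilation G
    = four_block_mat (0\<^sub>m p r) (X * G) (Z * mat_adjoint G) (0\<^sub>m q r)"
  unfolding herm_dilation_def using assms
  by (subst mult_four_block_mat[of _ p r _ r _ q _ _ r _ r]) auto

lemma herm_dilation_mult_block_diag:
  assumes "X \<in> carrier_mat p r" "Z \<in> carrier_mat q r" "G \<in> carrier_mat p q"
  shows "herm_dilation G * four_block_mat X (0\<^sub>m p r) (0\<^sub>m q r) Z
    = four_block_mat (0\<^sub>m p r) (G * Z) (mat_adjoint G * X) (0\<^sub>m q r)"
  unfolding herm_dilation_def using assms
  by (subst mult_four_block_mat[of _ p p _ q _ q _ _ r _ r]) auto

lemma four_block_minus:
  fixes A B C D A' B' C' D' :: "complex mat"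
  assumes "A \<in> carrier_mat p q" "B \<in> carrier_mat p s" "C \<in> carrier_mat k q" "D \<in> carrier_mat k s"
    "A' \<in> carrier_mat p q" "B' \<in> carrier_mat p s" "C' \<in> carrier_mat k q" "D' \<in> carrier_mat k s"
  shows "four_block_mat A B C D - four_block_mat A' B' C' D'
    = four_block_mat (A - A') (B - B') (C - C') (D - D')"
  by (rule eq_matI) (use assms in auto)

text \<open>The linear part of the coupled system for \<open>E11 = E22 = 0\<close>, as an operator on pairs. The same
operator for \<open>E11\<close> and \<open>E22\<close> in place of \<open>G1\<close> and \<open>G2\<close> collects the linear terms of the
perturbation.\<close>
definition coupled_op :: "complex mat \<Rightarrow> complex mat \<Rightarrow> complex mat \<times> complex mat \<Rightarrow> complex mat \<times> complex mat"
  where "coupled_op G1 G2 x = (fst x * G1 - G2 * snd x, snd x * mat_adjoint G1 - mat_adjoint G2 * fst x)"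

lemma coupled_op_carrier:
  assumes "G1 \<in> carrier_mat r r" "G2 \<in> carrier_mat p q"
    and "x \<in> carrier_mat p r \<times> carrier_mat q r"
  shows "coupled_op G1 G2 x \<in> carrier_mat p r \<times> carrier_mat q r"
proof -
  have x: "fst x \<in> carrier_mat p r" "snd x \<in> carrier_mat q r" using assms(3) by auto
  show ?thesis
    unfolding coupled_op_def mem_Times_iff fst_conv snd_conv
    by (intro conjI minus_carrier_mat mult_carrier_mat[OF assms(2) x(2)]
        mult_carrier_mat[OF mat_adjoint_carrier[OF assms(2)] x(1)])
qed

text \<open>This identity reduces the coupled system to a Sylvester equation with Hermitian coefficients:
block diagonal matrices are mapped to block off-diagonal ones, and the two off-diagonal blocks are
the two components of the coupled operator.\<close>
lemma block_diag_sylvester: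
  assumes X: "X \<in> carrier_mat p r" and Z: "Z \<in> carrier_mat q r"
    and G1: "G1 \<in> carrier_mat r r" and G2: "G2 \<in> carrier_mat p q"
  defines "Y \<equiv> four_block_mat X (0\<^sub>m p r) (0\<^sub>m q r) Z"
  shows "Y * herm_dilation G1 - herm_dilation G2 * Y
    = four_block_mat (0\<^sub>m p r) (fst (coupled_op G1 G2 (X, Z))) (snd (coupled_op G1 G2 (X, Z))) (0\<^sub>m q r)"
proof -
  have "X * G1 \<in> carrier_mat p r" "Z * mat_adjoint G1 \<in> carrier_mat q r"
    "G2 * Z \<in> carrier_mat p r" "mat_adjoint G2 * X \<in> carrier_mat q r"
    using X Z G1 G2 mat_adjoint_carrier[OF G1] mat_adjoint_carrier[OF G2] by auto
  then show ?thesis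
    unfolding Y_def block_diag_mult_herm_dilation[OF X Z G1] herm_dilation_mult_block_diag[OF X Z G2]
    by (subst four_block_minus[of _ p r _ r _ q]) (auto simp: coupled_op_def)
qed

lemma frob_norm_block_diag:
  assumes "X \<in> carrier_mat p r" "Z \<in> carrier_mat q r"
  shows "frob_norm (four_block_mat X (0\<^sub>m p r) (0\<^sub>m q r) Z) = sqrt ((frob_norm X)\<^sup>2 + (frob_norm Z)\<^sup>2)"
  using frob_norm_four_block[OF assms(1) zero_carrier_mat zero_carrier_mat assms(2)]
  by (intro real_sqrt_unique[symmetric]) auto

lemma frob_norm_block_offdiag:
  assumes "X \<in> carrier_mat p r" "Z \<in> carrier_mat q r"
  shows "frob_norm (four_block_mat (0\<^sub>m p r) X Z (0\<^sub>m q r)) = sqrt ((frob_norm X)\<^sup>2 + (frob_norm Z)\<^sup>2)"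
  using frob_norm_four_block[OF zero_carrier_mat assms zero_carrier_mat]
  by (intro real_sqrt_unique[symmetric]) auto

context
  fixes G1 G2 :: "complex mat" and p q r :: nat
  assumes G1: "G1 \<in> carrier_mat r r" and G2: "G2 \<in> carrier_mat p q"
begin

lemma sv_ext_square: "sv_ext G1 = sv G1"
  using G1 by (auto simp: sv_ext_def)

text \<open>An eigenvalue \<open>s\<close> of the dilation of \<open>G1\<close> and an eigenvalue \<open>t\<close> of the dilation of \<open>G2\<close> satisfy
\<open>\<bar>s - t\<bar> \<ge> \<bar>\<bar>s\<bar> - \<bar>t\<bar>\<bar>\<close>. So the signs that the dilations introduce do not reduce the gap.\<close>
lemma coupled_op_lower_bound_frobenius:
  assumes c: "0 \<le> c" and gap: "\<And>\<mu> \<nu>. \<mu> \<in># sv G1 \<Longrightarrow> \<nu> \<in># sv_ext G2 \<Longrightarrow> c \<le> \<bar>\<mu> - \<nu>\<bar>"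
    and x: "x \<in> carrier_mat p r \<times> carrier_mat q r"
  shows "c * sqrt ((frob_norm (fst x))\<^sup>2 + (frob_norm (snd x))\<^sup>2)
    \<le> sqrt ((frob_norm (fst (coupled_op G1 G2 x)))\<^sup>2 + (frob_norm (snd (coupled_op G1 G2 x)))\<^sup>2)"
proof -
  obtain Q1 l1 where Q1: "unitary_mat (r + r) Q1" "herm_dilation G1 * Q1 = Q1 * real_diag (r + r) l1"
    "\<And>i. i < r + r \<Longrightarrow> \<bar>l1 i\<bar> \<in># sv G1"
    using herm_dilation_diagonalization[OF G1] unfolding sv_ext_square by metis
  obtain Q2 l2 where Q2: "unitary_mat (p + q) Q2" "herm_dilation G2 * Q2 = Q2 * real_diag (p + q) l2"
    "\<And>i. i < p + q \<Longrightarrow> \<bar>l2 i\<bar> \<in># sv_ext G2"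
    using herm_dilation_diagonalization[OF G2] by metis
  have X: "fst x \<in> carrier_mat p r" and Z: "snd x \<in> carrier_mat q r" using x by auto
  have op: "fst (coupled_op G1 G2 x) \<in> carrier_mat p r" "snd (coupled_op G1 G2 x) \<in> carrier_mat q r"
    using coupled_op_carrier[OF G1 G2 x] by auto
  let ?Y = "four_block_mat (fst x) (0\<^sub>m p r) (0\<^sub>m q r) (snd x)"
  have Y: "?Y \<in> carrier_mat (p + q) (r + r)" using X Z by auto
  have "c \<le> \<bar>l1 j - l2 i\<bar>" if "i < p + q" "j < r + r" for i j
    using gap[OF Q1(3) Q2(3), OF that(2,1)] by linarith
  from sylvester_lower_bound[OF herm_dilation_carrier[OF G1] Q1(1,2)
      herm_dilation_carrier[OF G2] Q2(1,2) Y c this]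
  have "c * frob_norm ?Y \<le> frob_norm (?Y * herm_dilation G1 - herm_dilation G2 * ?Y)" .
  then show ?thesis
    unfolding block_diag_sylvester[OF X Z G1 G2]
    using frob_norm_block_diag[OF X Z] frob_norm_block_offdiag[OF op] by simp
qed

text \<open>A solution of the Sylvester equation for the dilations need not be block diagonal, but the
off-diagonal blocks of the equation involve only the diagonal blocks of the solution.\<close>
lemma coupled_op_surjective:
  assumes disjoint: "set_mset (sv G1) \<inter> set_mset (sv_ext G2) = {}"
    and y: "y \<in> carrier_mat p r \<times> carrier_mat q r"
  shows "\<exists>x \<in> carrier_mat p r \<times> carrier_mat q r. coupled_op G1 G2 x = y"
proof -
  obtain Q1 l1 where Q1: "unitary_mat (r + r) Q1" "herm_dilation G1 * Q1 = Q1 * real_diag (r + r) l1"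
    "\<And>i. i < r + r \<Longrightarrow> \<bar>l1 i\<bar> \<in># sv G1"
    using herm_dilation_diagonalization[OF G1] unfolding sv_ext_square by metis
  obtain Q2 l2 where Q2: "unitary_mat (p + q) Q2" "herm_dilation G2 * Q2 = Q2 * real_diag (p + q) l2"
    "\<And>i. i < p + q \<Longrightarrow> \<bar>l2 i\<bar> \<in># sv_ext G2"
    using herm_dilation_diagonalization[OF G2] by metis
  let ?C = "four_block_mat (0\<^sub>m p r) (fst y) (snd y) (0\<^sub>m q r)"
  have y': "fst y \<in> carrier_mat p r" "snd y \<in> carrier_mat q r" using y by auto
  have C: "?C \<in> carrier_mat (p + q) (r + r)" using y' by auto
  have "l1 j \<noteq> l2 i" if "i < p + q" "j < r + r" for i j
    using Q1(3)[OF that(2)] Q2(3)[OF that(1)] disjoint by auto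
  from sylvester_solvable[OF herm_dilation_carrier[OF G1] Q1(1,2)
      herm_dilation_carrier[OF G2] Q2(1,2) C this]
  obtain Y where Y: "Y \<in> carrier_mat (p + q) (r + r)"
    and eq: "Y * herm_dilation G1 - herm_dilation G2 * Y = ?C" by blast
  obtain X A B Z where split: "split_block Y p r = (X, A, B, Z)"
    by (cases "split_block Y p r") auto
  note Y_blocks = split_block[OF split, of q r] 
  have X: "X \<in> carrier_mat p r" and A: "A \<in> carrier_mat p r" and B: "B \<in> carrier_mat q r"
    and Z: "Z \<in> carrier_mat q r" and Y_eq: "Y = four_block_mat X A B Z"
    using Y_blocks Y by auto
  have G1a: "mat_adjoint G1 \<in> carrier_mat r r" and G2a: "mat_adjoint G2 \<in> carrier_mat q p"
    using G1 G2 by simp_all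
  have prods: "X * G1 \<in> carrier_mat p r" "A * mat_adjoint G1 \<in> carrier_mat p r"
    "B * G1 \<in> carrier_mat q r" "Z * mat_adjoint G1 \<in> carrier_mat q r"
    "G2 * B \<in> carrier_mat p r" "G2 * Z \<in> carrier_mat p r"
    "mat_adjoint G2 * X \<in> carrier_mat q r" "mat_adjoint G2 * A \<in> carrier_mat q r"
    using X A B Z G1 G2 G1a G2a by auto
  have "Y * herm_dilation G1 = four_block_mat (A * mat_adjoint G1) (X * G1) (Z * mat_adjoint G1) (B * G1)"
    unfolding Y_eq herm_dilation_def using X A B Z G1 G1a prods
    by (subst mult_four_block_mat[of _ p r _ r _ q _ _ r _ r]) auto
  moreover have "herm_dilation G2 * Y = four_block_mat (G2 * B) (G2 * Z) (mat_adjoint G2 * X) (mat_adjoint G2 * A)"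
    unfolding Y_eq herm_dilation_def using X A B Z G2 G2a prods
    by (subst mult_four_block_mat[of _ p p _ q _ q _ _ r _ r]) auto
  ultimately have eq': "four_block_mat (A * mat_adjoint G1 - G2 * B) (X * G1 - G2 * Z)
      (Z * mat_adjoint G1 - mat_adjoint G2 * X) (B * G1 - mat_adjoint G2 * A) = ?C"
    using four_block_minus[OF prods(2,1,4,3) prods(5,6,7,8)] eq by simp
  have "X * G1 - G2 * Z = fst y"
  proof (rule eq_matI)
    fix i j assume "i < dim_row (fst y)" "j < dim_col (fst y)"
    then show "(X * G1 - G2 * Z) $$ (i, j) = fst y $$ (i, j)"
      using arg_cong[OF eq', of "\<lambda>M. M $$ (i, r + j)"] y' prods X Z G1 G2 A B by auto
  qed (use y' prods G2 Z in auto)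
  moreover have "Z * mat_adjoint G1 - mat_adjoint G2 * X = snd y"
  proof (rule eq_matI)
    fix i j assume "i < dim_row (snd y)" "j < dim_col (snd y)"
    then show "(Z * mat_adjoint G1 - mat_adjoint G2 * X) $$ (i, j) = snd y $$ (i, j)"
      using arg_cong[OF eq', of "\<lambda>M. M $$ (p + i, j)"] y' prods X Z G1 G2 A B by auto
  qed (use y' prods G2 X in auto)
  ultimately show ?thesis
    using X Z by (intro bexI[of _ "(X, Z)"]) (auto simp: coupled_op_def)
qed

text \<open>When all singular values of \<open>G1\<close> exceed those of \<open>G2\<close>, it suffices to look at the component in
which the unknown is larger: there \<open>G1\<close> expands it at least by the factor \<open>a\<close>, and the term with
\<open>G2\<close> is at most \<open>b\<close> times the smaller unknown. The one-sided bounds are read off from the dilations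
at pairs with a zero component.\<close>
lemma coupled_op_lower_bound_max:
  assumes a: "0 \<le> a" "\<And>\<mu>. \<mu> \<in># sv G1 \<Longrightarrow> a \<le> \<mu>"
    and b: "0 \<le> b" "\<And>\<nu>. \<nu> \<in># sv_ext G2 \<Longrightarrow> \<nu> \<le> b"
    and x: "x \<in> carrier_mat p r \<times> carrier_mat q r"
  shows "(a - b) * max (frob_norm (fst x)) (frob_norm (snd x))
    \<le> max (frob_norm (fst (coupled_op G1 G2 x))) (frob_norm (snd (coupled_op G1 G2 x)))"
proof -
  obtain Q1 l1 where Q1: "unitary_mat (r + r) Q1" "herm_dilation G1 * Q1 = Q1 * real_diag (r + r) l1"
    "\<And>i. i < r + r \<Longrightarrow> \<bar>l1 i\<bar> \<in># sv G1"
    using herm_dilation_diagonalization[OF G1] unfolding sv_ext_square by metis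
  obtain Q2 l2 where Q2: "unitary_mat (p + q) Q2" "herm_dilation G2 * Q2 = Q2 * real_diag (p + q) l2"
    "\<And>i. i < p + q \<Longrightarrow> \<bar>l2 i\<bar> \<in># sv_ext G2"
    using herm_dilation_diagonalization[OF G2] by metis
  have lower: "a * sqrt ((frob_norm X)\<^sup>2 + (frob_norm Z)\<^sup>2)
      \<le> sqrt ((frob_norm (X * G1))\<^sup>2 + (frob_norm (Z * mat_adjoint G1))\<^sup>2)"
    if X: "X \<in> carrier_mat p r" and Z: "Z \<in> carrier_mat q r" for X Z
  proof -
    have "four_block_mat X (0\<^sub>m p r) (0\<^sub>m q r) Z \<in> carrier_mat (p + q) (r + r)" using X Z by auto
    from frob_norm_mult_diagonalized_ge[OF herm_dilation_carrier[OF G1] Q1(1,2) this a(1) a(2)[OF Q1(3)]]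
    show ?thesis
      unfolding block_diag_mult_herm_dilation[OF X Z G1] frob_norm_block_diag[OF X Z]
      using frob_norm_block_offdiag[OF mult_carrier_mat[OF X G1] mult_carrier_mat[OF Z mat_adjoint_carrier[OF G1]]]
      by simp
  qed
  have upper: "sqrt ((frob_norm (G2 * Z))\<^sup>2 + (frob_norm (mat_adjoint G2 * X))\<^sup>2)
      \<le> b * sqrt ((frob_norm X)\<^sup>2 + (frob_norm Z)\<^sup>2)"
    if X: "X \<in> carrier_mat p r" and Z: "Z \<in> carrier_mat q r" for X Z
  proof -
    have "four_block_mat X (0\<^sub>m p r) (0\<^sub>m q r) Z \<in> carrier_mat (p + q) (r + r)" using X Z by auto
    from frob_norm_diagonalized_mult_le[OF herm_dilation_carrier[OF G2] Q2(1,2) this b(1) b(2)[OF Q2(3)]]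
    show ?thesis
      unfolding herm_dilation_mult_block_diag[OF X Z G2] frob_norm_block_diag[OF X Z]
      using frob_norm_block_offdiag[OF mult_carrier_mat[OF G2 Z] mult_carrier_mat[OF mat_adjoint_carrier[OF G2] X]]
      by simp
  qed
  have G1a: "mat_adjoint G1 \<in> carrier_mat r r" and G2a: "mat_adjoint G2 \<in> carrier_mat q p"
    using G1 G2 by simp_all
  obtain X Z where x_eq: "x = (X, Z)" and X: "X \<in> carrier_mat p r" and Z: "Z \<in> carrier_mat q r"
    using x by auto
  have prods: "X * G1 \<in> carrier_mat p r" "Z * mat_adjoint G1 \<in> carrier_mat q r"
    "G2 * Z \<in> carrier_mat p r" "mat_adjoint G2 * X \<in> carrier_mat q r"
    using X Z G1 G2 G1a G2a by auto
  have zeros: "0\<^sub>m q r * mat_adjoint G1 = 0\<^sub>m q r" "0\<^sub>m p r * G1 = 0\<^sub>m p r"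
    "mat_adjoint G2 * 0\<^sub>m p r = 0\<^sub>m q r" "G2 * 0\<^sub>m q r = 0\<^sub>m p r"
    using G1 G2 G1a G2a by auto
  \<comment> \<open>The other component is set to zero.\<close>
  have XG: "a * frob_norm X \<le> frob_norm (X * G1)"
    using lower[OF X zero_carrier_mat] by (simp add: zeros)
  have ZG: "a * frob_norm Z \<le> frob_norm (Z * mat_adjoint G1)"
    using lower[OF zero_carrier_mat Z] by (simp add: zeros)
  have GZ: "frob_norm (G2 * Z) \<le> b * frob_norm Z"
    using upper[OF zero_carrier_mat Z] by (simp add: zeros)
  have GX: "frob_norm (mat_adjoint G2 * X) \<le> b * frob_norm X"
    using upper[OF X zero_carrier_mat] by (simp add: zeros)
  have 1: "a * frob_norm X - b * frob_norm Z \<le> frob_norm (X * G1 - G2 * Z)"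
    using frob_norm_triangle_sub[OF prods(1,3)] XG GZ by linarith
  have 2: "a * frob_norm Z - b * frob_norm X \<le> frob_norm (Z * mat_adjoint G1 - mat_adjoint G2 * X)"
    using frob_norm_triangle_sub[OF prods(2,4)] ZG GX by linarith
  show ?thesis
  proof (cases "frob_norm Z \<le> frob_norm X")
    case True
    then have "b * frob_norm Z \<le> b * frob_norm X" using b(1) by (rule mult_left_mono)
    then show ?thesis using 1 True by (simp add: x_eq coupled_op_def algebra_simps max_def)
  next
    case False
    then have "b * frob_norm X \<le> b * frob_norm Z" using b(1) by (intro mult_left_mono) auto
    then show ?thesis using 2 False by (simp add: x_eq coupled_op_def algebra_simps max_def)
  qed
qed

end

section \<open>Fixed points in spaces of pairs of matrices\<close>

text \<open>A pair of matrices is measured by combining its two Frobenius norms, once by the Euclidean norm of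
the plane and once by the maximum norm. These are the properties of the two norms on which the
fixed point argument rests; \<open>commute\<close> is needed because the two equations exchange the roles of the
unknowns.\<close>
locale pair_norm =
  fixes nu :: "real \<Rightarrow> real \<Rightarrow> real"
  assumes mono: "\<lbrakk>0 \<le> a; 0 \<le> b; a \<le> a'; b \<le> b'\<rbrakk> \<Longrightarrow> nu a b \<le> nu a' b'"
    and triangle: "\<lbrakk>0 \<le> a; 0 \<le> b; 0 \<le> a'; 0 \<le> b'\<rbrakk> \<Longrightarrow> nu (a + a') (b + b') \<le> nu a b + nu a' b'"
    and scale: "\<lbrakk>0 \<le> c; 0 \<le> a; 0 \<le> b\<rbrakk> \<Longrightarrow> nu (c * a) (c * b) = c * nu a b"
    and commute: "nu a b = nu b a"
    and ge: "\<lbrakk>0 \<le> a; 0 \<le> b\<rbrakk> \<Longrightarrow> a \<le> nu a b"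
    and le_add: "\<lbrakk>0 \<le> a; 0 \<le> b\<rbrakk> \<Longrightarrow> nu a b \<le> a + b"
begin

lemma nonneg: "\<lbrakk>0 \<le> a; 0 \<le> b\<rbrakk> \<Longrightarrow> 0 \<le> nu a b"
  using ge order_trans by blast

lemma ge2: "\<lbrakk>0 \<le> a; 0 \<le> b\<rbrakk> \<Longrightarrow> b \<le> nu a b"
  using ge commute by metis

text \<open>The form in which the quadratic terms are estimated: in the first equation they carry the
factors \<open>a b'\<close>, in the second \<open>b a'\<close>.\<close>
lemma cross:
  assumes "0 \<le> a" "0 \<le> b" "0 \<le> a'" "0 \<le> b'"
  shows "nu (a * b') (b * a') \<le> nu a b * nu a' b'"
proof -
  have "nu (a * b') (b * a') \<le> nu (nu a' b' * a) (nu a' b' * b)"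
    using assms ge[of a' b'] ge2[of a' b'] mult_left_mono[of b' "nu a' b'" a] mult_left_mono[of a' "nu a' b'" b]
    by (intro mono) (auto simp: mult.commute)
  also have "\<dots> = nu a b * nu a' b'"
    using assms by (simp add: scale nonneg)
  finally show ?thesis .
qed

lemma triangle3:
  assumes "0 \<le> a" "0 \<le> b" "0 \<le> a'" "0 \<le> b'" "0 \<le> a''" "0 \<le> b''"
  shows "nu (a + a' + a'') (b + b' + b'') \<le> nu a b + nu a' b' + nu a'' b''"
  using triangle[of "a + a'" "b + b'" a'' b''] triangle[of a b a' b'] assms by simp

definition pnorm :: "complex mat \<times> complex mat \<Rightarrow> real" where
  "pnorm x = nu (frob_norm (fst x)) (frob_norm (snd x))"

text \<open>There is no subtraction on pairs of matrices, so the norm of the difference is spelled out.\<close>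
definition pdist :: "complex mat \<times> complex mat \<Rightarrow> complex mat \<times> complex mat \<Rightarrow> real" where
  "pdist x y = nu (frob_norm (fst x - fst y)) (frob_norm (snd x - snd y))"

end

lemma pair_norm_euclidean: "pair_norm (\<lambda>a b. sqrt (a\<^sup>2 + b\<^sup>2))"
proof
  fix a b a' b' c :: real
  show "sqrt ((a + a')\<^sup>2 + (b + b')\<^sup>2) \<le> sqrt (a\<^sup>2 + b\<^sup>2) + sqrt (a'\<^sup>2 + b'\<^sup>2)"
    by (rule real_sqrt_sum_squares_triangle_ineq)
  show "sqrt (a\<^sup>2 + b\<^sup>2) \<le> a + b" if "0 \<le> a" "0 \<le> b"
    using that sqrt_sum_squares_le_sum by blast
  show "sqrt ((c * a)\<^sup>2 + (c * b)\<^sup>2) = c * sqrt (a\<^sup>2 + b\<^sup>2)" if "0 \<le> c"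
    using that by (simp add: power_mult_distrib real_sqrt_mult flip: distrib_left)
qed (auto intro: add_mono power_mono simp: add.commute)

lemma pair_norm_max: "pair_norm max"
proof
  show "max (c * a) (c * b) = c * max a b" if "0 \<le> c" for a b c :: real
    using that by (simp add: max_mult_distrib_left)
qed auto

text \<open>Completeness is inherited from the complex numbers entry by entry, as there are finitely many
entries.\<close>
lemma frob_norm_Cauchy_limit:
  fixes X :: "nat \<Rightarrow> complex mat"
  assumes X: "\<And>n. X n \<in> carrier_mat p q"
    and Cauchy: "\<And>e. e > 0 \<Longrightarrow> \<exists>N. \<forall>m\<ge>N. \<forall>n\<ge>N. frob_norm (X m - X n) < e"
  shows "\<exists>L \<in> carrier_mat p q. (\<lambda>n. frob_norm (X n - L)) \<longlonglongrightarrow> 0"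
proof -
  have dims: "dim_row (X n) = p" "dim_col (X n) = q" for n using X by auto
  have "convergent (\<lambda>n. X n $$ (i, j))" if ij: "i < p" "j < q" for i j
  proof (rule Cauchy_convergent, rule metric_CauchyI)
    fix e :: real assume "e > 0"
    then obtain N where N: "\<And>m n. m \<ge> N \<Longrightarrow> n \<ge> N \<Longrightarrow> frob_norm (X m - X n) < e"
      using Cauchy by blast
    have "dist (X m $$ (i, j)) (X n $$ (i, j)) < e" if "m \<ge> N" "n \<ge> N" for m n
      using cmod_index_le_frob_norm[of i "X m - X n" j] N[OF that] ij dims by (simp add: dist_norm)
    then show "\<exists>N. \<forall>m\<ge>N. \<forall>n\<ge>N. dist (X m $$ (i, j)) (X n $$ (i, j)) < e" by blast
  qed
  then have lim: "(\<lambda>n. X n $$ (i, j)) \<longlonglongrightarrow> lim (\<lambda>n. X n $$ (i, j))" if "i < p" "j < q" for i j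
    using that by (simp add: convergent_LIMSEQ_iff)
  define L where "L = mat p q (\<lambda>(i, j). lim (\<lambda>n. X n $$ (i, j)))"
  have L: "L \<in> carrier_mat p q" by (simp add: L_def)
  have "(\<lambda>n. X n $$ (i, j) - L $$ (i, j)) \<longlonglongrightarrow> 0" if "i < p" "j < q" for i j
    using lim[OF that] that by (simp add: L_def LIM_zero_iff)
  then have "(\<lambda>n. sqrt (\<Sum>i<p. \<Sum>j<q. (cmod (X n $$ (i, j) - L $$ (i, j)))\<^sup>2)) \<longlonglongrightarrow> sqrt (\<Sum>i<p. \<Sum>j<q. (cmod 0)\<^sup>2)"
    by (intro tendsto_intros) auto
  moreover have "frob_norm (X n - L) = sqrt (\<Sum>i<p. \<Sum>j<q. (cmod (X n $$ (i, j) - L $$ (i, j)))\<^sup>2)" for n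
    using L dims by (simp add: frob_norm_def)
  ultimately show ?thesis by (intro bexI[OF _ L]) simp
qed

context pair_norm
begin

lemma pnorm_nonneg: "0 \<le> pnorm x" by (simp add: pnorm_def nonneg)

lemma pdist_nonneg: "0 \<le> pdist x y" by (simp add: pdist_def nonneg)

context
  fixes p q r :: nat and S :: "(complex mat \<times> complex mat) set"
  defines "S \<equiv> carrier_mat p r \<times> carrier_mat q r"
begin

lemma pdist_commute:
  assumes "x \<in> S" "y \<in> S"
  shows "pdist x y = pdist y x"
proof -
  have "frob_norm (fst x - fst y) = frob_norm (fst y - fst x)"
    "frob_norm (snd x - snd y) = frob_norm (snd y - snd x)"
    using assms by (auto simp: S_def intro: frob_norm_minus_commute)
  then show ?thesis by (simp add: pdist_def)
qed

lemma pdist_eq_0: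
  assumes x: "x \<in> S" and y: "y \<in> S"
  shows "pdist x y = 0 \<longleftrightarrow> x = y"
proof
  assume "pdist x y = 0"
  then have z: "frob_norm (fst x - fst y) = 0" "frob_norm (snd x - snd y) = 0"
    using ge[of "frob_norm (fst x - fst y)" "frob_norm (snd x - snd y)"]
      ge2[of "frob_norm (fst x - fst y)" "frob_norm (snd x - snd y)"]
    by (auto simp: pdist_def intro!: antisym)
  have eq: "A = B" if AB: "A \<in> carrier_mat k s" "B \<in> carrier_mat k s" and "frob_norm (A - B) = 0"
    for A B :: "complex mat" and k s
  proof -
    have d: "A - B = 0\<^sub>m k s" using that by (intro frob_norm_eq_0) auto
    show ?thesis
    proof (rule eq_matI)
      fix i j assume "i < dim_row B" "j < dim_col B"
      then show "A $$ (i, j) = B $$ (i, j)"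
        using arg_cong[OF d, of "\<lambda>M. M $$ (i, j)"] AB by simp
    qed (use AB in auto)
  qed
  show "x = y"
    using eq[OF _ _ z(1)] eq[OF _ _ z(2)] x y by (auto simp: S_def prod_eq_iff)
next
  assume "x = y"
  then have "fst x - fst y = 0\<^sub>m p r" "snd x - snd y = 0\<^sub>m q r" using x by (auto simp: S_def)
  then have "pdist x y = nu 0 0" by (simp add: pdist_def)
  then show "pdist x y = 0" using le_add[of 0 0] nonneg[of 0 0] by simp
qed

lemma pdist_triangle:
  assumes "x \<in> S" "y \<in> S" "z \<in> S"
  shows "pdist x z \<le> pdist x y + pdist y z"
proof -
  have "pdist x z \<le> nu (frob_norm (fst x - fst y) + frob_norm (fst y - fst z))
      (frob_norm (snd x - snd y) + frob_norm (snd y - snd z))"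
    unfolding pdist_def using assms
    by (intro mono frob_norm_triangle_diff[of _ p r] frob_norm_triangle_diff[of _ q r]) (auto simp: S_def)
  also have "\<dots> \<le> pdist x y + pdist y z"
    unfolding pdist_def by (rule triangle) auto
  finally show ?thesis .
qed

lemma pnorm_le_pdist:
  assumes "x \<in> S" "y \<in> S"
  shows "pnorm x \<le> pdist x y + pnorm y"
proof -
  have "frob_norm (fst x) \<le> frob_norm (fst x - fst y) + frob_norm (fst y)"
    "frob_norm (snd x) \<le> frob_norm (snd x - snd y) + frob_norm (snd y)"
    using assms by (auto simp: S_def intro: frob_norm_triangle_sub)
  then have "pnorm x \<le> nu (frob_norm (fst x - fst y) + frob_norm (fst y)) (frob_norm (snd x - snd y) + frob_norm (snd y))"
    unfolding pnorm_def by (intro mono) auto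
  also have "\<dots> \<le> pdist x y + pnorm y"
    unfolding pdist_def pnorm_def by (rule triangle) auto
  finally show ?thesis .
qed

text \<open>Banach's theorem on a closed ball, which is complete because the limit of a sequence in the ball
stays in it.\<close>
lemma contraction_fixed_point_on_ball:
  assumes \<rho>: "0 \<le> \<rho>" and k: "k < 1"
    and f: "\<And>x. x \<in> S \<Longrightarrow> pnorm x \<le> \<rho> \<Longrightarrow> f x \<in> S \<and> pnorm (f x) \<le> \<rho>"
    and con: "\<And>x y. x \<in> S \<Longrightarrow> y \<in> S \<Longrightarrow> pnorm x \<le> \<rho> \<Longrightarrow> pnorm y \<le> \<rho> \<Longrightarrow> pdist (f x) (f y) \<le> k * pdist x y"
  shows "\<exists>x \<in> S. pnorm x \<le> \<rho> \<and> f x = x"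
proof -
  define M where "M = {x \<in> S. pnorm x \<le> \<rho>}"
  \<comment> \<open>The metric has to be symmetric also outside the ball, where the dimensions need not agree.\<close>
  define d where "d x y = (if x \<in> M \<and> y \<in> M then pdist x y else 0)" for x y
  have M: "x \<in> S" "pnorm x \<le> \<rho>" if "x \<in> M" for x using that by (auto simp: M_def)
  have d: "d x y = pdist x y" if "x \<in> M" "y \<in> M" for x y using that by (simp add: d_def)
  interpret Metric_space M d
  proof
    show "0 \<le> d x y" for x y by (simp add: d_def pdist_nonneg)
    show "d x y = d y x" for x y using M pdist_commute by (simp add: d_def)
    show "d x y = 0 \<longleftrightarrow> x = y" if "x \<in> M" "y \<in> M" for x y
      using that M pdist_eq_0 by (simp add: d)
    show "d x z \<le> d x y + d y z" if "x \<in> M" "y \<in> M" "z \<in> M" for x y z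
      using that M pdist_triangle by (simp add: d)
  qed
  have mcomplete
    unfolding mcomplete_def
  proof (intro allI impI)
    fix \<sigma> assume Cauchy: "MCauchy \<sigma>"
    then have \<sigma>M: "\<sigma> n \<in> M" for n by (auto simp: MCauchy_def)
    then have \<sigma>S: "fst (\<sigma> n) \<in> carrier_mat p r" "snd (\<sigma> n) \<in> carrier_mat q r" for n
      using M(1)[of "\<sigma> n"] by (auto simp: S_def)
    have "\<exists>N. \<forall>m\<ge>N. \<forall>n\<ge>N. pdist (\<sigma> m) (\<sigma> n) < e" if "e > 0" for e
      using Cauchy that d[OF \<sigma>M \<sigma>M] unfolding MCauchy_def by metis
    moreover have "frob_norm (fst (\<sigma> m) - fst (\<sigma> n)) \<le> pdist (\<sigma> m) (\<sigma> n)"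
      "frob_norm (snd (\<sigma> m) - snd (\<sigma> n)) \<le> pdist (\<sigma> m) (\<sigma> n)" for m n
      unfolding pdist_def by (auto intro: ge ge2)
    ultimately have C1: "\<exists>N. \<forall>m\<ge>N. \<forall>n\<ge>N. frob_norm (fst (\<sigma> m) - fst (\<sigma> n)) < e"
      and C2: "\<exists>N. \<forall>m\<ge>N. \<forall>n\<ge>N. frob_norm (snd (\<sigma> m) - snd (\<sigma> n)) < e" if "e > 0" for e
      using that by (meson le_less_trans)+
    obtain L1 where L1: "L1 \<in> carrier_mat p r" "(\<lambda>n. frob_norm (fst (\<sigma> n) - L1)) \<longlonglongrightarrow> 0"
      using frob_norm_Cauchy_limit[of "\<lambda>n. fst (\<sigma> n)", OF \<sigma>S(1) C1] by blast
    obtain L2 where L2: "L2 \<in> carrier_mat q r" "(\<lambda>n. frob_norm (snd (\<sigma> n) - L2)) \<longlonglongrightarrow> 0"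
      using frob_norm_Cauchy_limit[of "\<lambda>n. snd (\<sigma> n)", OF \<sigma>S(2) C2] by blast
    let ?L = "(L1, L2)"
    have LS: "?L \<in> S" using L1 L2 by (simp add: S_def)
    have lim: "(\<lambda>n. pdist (\<sigma> n) ?L) \<longlonglongrightarrow> 0"
    proof (rule tendsto_sandwich[of "\<lambda>_. 0"])
      show "(\<lambda>n. frob_norm (fst (\<sigma> n) - L1) + frob_norm (snd (\<sigma> n) - L2)) \<longlonglongrightarrow> 0"
        using tendsto_add[OF L1(2) L2(2)] by simp
      show "\<forall>\<^sub>F n in sequentially. pdist (\<sigma> n) ?L \<le> frob_norm (fst (\<sigma> n) - L1) + frob_norm (snd (\<sigma> n) - L2)"
        by (rule always_eventually) (simp add: pdist_def le_add)
    qed (auto simp: pdist_nonneg)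
    have "pnorm ?L \<le> pdist (\<sigma> n) ?L + \<rho>" for n
      using pnorm_le_pdist[OF LS M(1)[OF \<sigma>M[of n]]] pdist_commute[OF LS M(1)[OF \<sigma>M[of n]]] M(2)[OF \<sigma>M[of n]]
      by simp
    then have "pnorm ?L \<le> 0 + \<rho>"
      by (intro LIMSEQ_le_const[OF tendsto_add[OF lim tendsto_const]]) auto
    then have LM: "?L \<in> M" using LS by (simp add: M_def)
    have "limitin mtopology \<sigma> ?L sequentially"
      unfolding limit_metric_sequentially
    proof (intro conjI allI impI)
      fix e :: real assume "0 < e"
      then obtain N where "\<And>n. n \<ge> N \<Longrightarrow> \<bar>pdist (\<sigma> n) ?L\<bar> < e"
        using lim unfolding LIMSEQ_iff real_norm_def by fastforce
      then have "\<forall>n\<ge>N. \<sigma> n \<in> M \<and> d (\<sigma> n) ?L < e"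
        by (auto simp: d[OF \<sigma>M LM] abs_less_iff intro: \<sigma>M)
      then show "\<exists>N. \<forall>n\<ge>N. \<sigma> n \<in> M \<and> d (\<sigma> n) ?L < e" ..
    qed (rule LM)
    then show "\<exists>x. limitin mtopology \<sigma> x sequentially" ..
  qed
  moreover have "(0\<^sub>m p r, 0\<^sub>m q r) \<in> M"
    using \<rho> le_add[of 0 0] by (simp add: M_def S_def pnorm_def)
  then have "M \<noteq> {}" by blast
  moreover have fM: "f x \<in> M" if "x \<in> M" for x
    using f[OF M[OF that]] by (simp add: M_def)
  then have "f \<in> M \<rightarrow> M" by blast
  moreover have "d (f x) (f y) \<le> k * d x y" if "x \<in> M" "y \<in> M" for x y
    unfolding d[OF that] d[OF fM[OF that(1)] fM[OF that(2)]]
    by (rule con[OF M(1)[OF that(1)] M(1)[OF that(2)] M(2)[OF that(1)] M(2)[OF that(2)]])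
  ultimately obtain x where "x \<in> M" "f x = x"
    using Banach_fixedpoint_thm[OF _ _ _ k] by metis
  then show ?thesis using M by metis
qed

text \<open>The equation \<open>T x = R x\<close> says that \<open>x\<close> is a fixed point of \<open>T\<^sup>-\<^sup>1 \<circ> R\<close>, and the lower bound on
\<open>T\<close> makes \<open>T\<^sup>-\<^sup>1\<close> Lipschitz with constant \<open>1 / \<delta>\<close>.\<close>
lemma perturbed_equation_solvable:
  assumes \<delta>: "0 < \<delta>" and \<rho>: "0 \<le> \<rho>" and L: "L < \<delta>"
    and lower: "\<And>x. x \<in> S \<Longrightarrow> \<delta> * pnorm x \<le> pnorm (T x)"
    and lower_diff: "\<And>x y. x \<in> S \<Longrightarrow> y \<in> S \<Longrightarrow> \<delta> * pdist x y \<le> pdist (T x) (T y)"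
    and surj: "\<And>y. y \<in> S \<Longrightarrow> \<exists>x \<in> S. T x = y"
    and R: "\<And>x. x \<in> S \<Longrightarrow> R x \<in> S"
    and bound: "\<And>x. x \<in> S \<Longrightarrow> pnorm x \<le> \<rho> \<Longrightarrow> pnorm (R x) \<le> \<delta> * \<rho>"
    and lip: "\<And>x y. x \<in> S \<Longrightarrow> y \<in> S \<Longrightarrow> pnorm x \<le> \<rho> \<Longrightarrow> pnorm y \<le> \<rho> \<Longrightarrow> pdist (R x) (R y) \<le> L * pdist x y"
  shows "\<exists>x \<in> S. pnorm x \<le> \<rho> \<and> T x = R x"
proof -
  define f where "f x = (SOME z. z \<in> S \<and> T z = R x)" for x
  have f: "f x \<in> S" "T (f x) = R x" if "x \<in> S" for x
    using someI_ex[of "\<lambda>z. z \<in> S \<and> T z = R x"] surj[OF R[OF that]] by (auto simp: f_def)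
  have "\<exists>x \<in> S. pnorm x \<le> \<rho> \<and> f x = x"
  proof (rule contraction_fixed_point_on_ball[OF \<rho>, of "L / \<delta>"])
    show "L / \<delta> < 1" using L \<delta> by simp
    show "f x \<in> S \<and> pnorm (f x) \<le> \<rho>" if "x \<in> S" "pnorm x \<le> \<rho>" for x
    proof
      have "\<delta> * pnorm (f x) \<le> \<delta> * \<rho>"
        using lower[OF f(1)[OF that(1)]] bound[OF that] by (simp add: f(2)[OF that(1)])
      then show "pnorm (f x) \<le> \<rho>" using \<delta> by simp
    qed (rule f(1)[OF that(1)])
    show "pdist (f x) (f y) \<le> L / \<delta> * pdist x y"
      if xy: "x \<in> S" "y \<in> S" "pnorm x \<le> \<rho>" "pnorm y \<le> \<rho>" for x y
      using lower_diff[OF f(1)[OF xy(1)] f(1)[OF xy(2)]] lip[OF xy] \<delta>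
      by (simp add: f(2) xy divide_simps mult.commute)
  qed
  then show ?thesis using f(2) by metis
qed

end

end

section \<open>The coupled system\<close>

lemma frob_norm_triple_le:
  assumes A: "A \<in> carrier_mat a b" and K: "K \<in> carrier_mat b c" and B: "B \<in> carrier_mat c d"
    and le: "frob_norm (A * K) \<le> e * frob_norm A"
  shows "frob_norm (A * K * B) \<le> e * (frob_norm A * frob_norm B)"
  using frob_norm_mult[OF mult_carrier_mat[OF A K] B] mult_right_mono[OF le, of "frob_norm B"]
  by (simp add: mult.assoc)

text \<open>From \<open>A K B - A' K B' = (A - A') K B + A' K (B - B')\<close>.\<close>
lemma frob_norm_triple_diff_le:
  assumes A: "A \<in> carrier_mat a b" "A' \<in> carrier_mat a b" and K: "K \<in> carrier_mat b c"
    and B: "B \<in> carrier_mat c d" "B' \<in> carrier_mat c d"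
    and le: "\<And>X. X \<in> carrier_mat a b \<Longrightarrow> frob_norm (X * K) \<le> e * frob_norm X"
  shows "frob_norm (A * K * B - A' * K * B')
    \<le> e * (frob_norm (A - A') * frob_norm B + frob_norm A' * frob_norm (B - B'))"
proof -
  have AK: "A * K \<in> carrier_mat a c" "A' * K \<in> carrier_mat a c" using A K by auto
  have 1: "A * K * B - A' * K * B = (A - A') * K * B"
    using minus_mult_distrib_mat[OF A K] minus_mult_distrib_mat[OF AK B(1)] by simp
  have 2: "A' * K * B - A' * K * B' = A' * K * (B - B')"
    using mult_minus_distrib_mat[OF AK(2) B] by simp
  have dA: "A - A' \<in> carrier_mat a b" and dB: "B - B' \<in> carrier_mat c d" using A B by auto
  have "frob_norm (A * K * B - A' * K * B')
      \<le> frob_norm (A * K * B - A' * K * B) + frob_norm (A' * K * B - A' * K * B')"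
    using mult_carrier_mat[OF AK(1) B(1)] mult_carrier_mat[OF AK(2) B(1)] mult_carrier_mat[OF AK(2) B(2)]
    by (rule frob_norm_triangle_diff)
  also have "\<dots> \<le> e * (frob_norm (A - A') * frob_norm B) + e * (frob_norm A' * frob_norm (B - B'))"
    unfolding 1 2
    by (intro add_mono frob_norm_triple_le[OF dA K B(1) le[OF dA]] frob_norm_triple_le[OF A(2) K dB le[OF A(2)]])
  finally show ?thesis by (simp add: distrib_left)
qed

definition quadratic_op :: "complex mat \<Rightarrow> complex mat \<Rightarrow> complex mat \<times> complex mat \<Rightarrow> complex mat \<times> complex mat"
  where "quadratic_op E12 E21 x = (fst x * E12 * snd x, snd x * mat_adjoint E21 * fst x)"

text \<open>Everything in the coupled system except the linear part that belongs to \<open>G1\<close> and \<open>G2\<close>. Only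
that part is inverted; the linear terms with \<open>E11\<close> and \<open>E22\<close> stay on the right-hand side, where
they cost exactly the difference between \<open>\<delta>\<close> and \<open>\<delta> - \<parallel>E11\<parallel> - \<parallel>E22\<parallel>\<close>.\<close>
definition remainder_op ::
  "complex mat \<Rightarrow> complex mat \<Rightarrow> complex mat \<Rightarrow> complex mat \<Rightarrow> complex mat \<times> complex mat \<Rightarrow> complex mat \<times> complex mat"
  where "remainder_op E11 E12 E21 E22 x =
    (E21 - fst (quadratic_op E12 E21 x) - fst (coupled_op E11 E22 x),
     mat_adjoint E12 - snd (quadratic_op E12 E21 x) - snd (coupled_op E11 E22 x))"

lemma coupled_op_diff:
  assumes G1: "G1 \<in> carrier_mat r r" and G2: "G2 \<in> carrier_mat p q"
    and x: "x \<in> carrier_mat p r \<times> carrier_mat q r" and y: "y \<in> carrier_mat p r \<times> carrier_mat q r"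
  shows "coupled_op G1 G2 (fst x - fst y, snd x - snd y)
    = (fst (coupled_op G1 G2 x) - fst (coupled_op G1 G2 y), snd (coupled_op G1 G2 x) - snd (coupled_op G1 G2 y))"
proof -
  have X: "fst x \<in> carrier_mat p r" "fst y \<in> carrier_mat p r"
    and Z: "snd x \<in> carrier_mat q r" "snd y \<in> carrier_mat q r" using x y by auto
  have G1a: "mat_adjoint G1 \<in> carrier_mat r r" and G2a: "mat_adjoint G2 \<in> carrier_mat q p"
    using G1 G2 by simp_all
  have swap: "(A - B) - (C - D) = (A - C) - (B - D)"
    if "A \<in> carrier_mat k s" "B \<in> carrier_mat k s" "C \<in> carrier_mat k s" "D \<in> carrier_mat k s"
    for A B C D :: "complex mat" and k s
    using that by (intro eq_matI) auto
  show ?thesis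
    unfolding coupled_op_def fst_conv snd_conv minus_mult_distrib_mat[OF X G1] minus_mult_distrib_mat[OF Z G1a]
      mult_minus_distrib_mat[OF G2 Z] mult_minus_distrib_mat[OF G2a X]
    using swap[OF mult_carrier_mat[OF X(1) G1] mult_carrier_mat[OF X(2) G1]
        mult_carrier_mat[OF G2 Z(1)] mult_carrier_mat[OF G2 Z(2)]]
      swap[OF mult_carrier_mat[OF Z(1) G1a] mult_carrier_mat[OF Z(2) G1a]
        mult_carrier_mat[OF G2a X(1)] mult_carrier_mat[OF G2a X(2)]]
    by simp
qed

lemma coupled_system_if_remainder:
  assumes G1: "G1 \<in> carrier_mat r r" and G2: "G2 \<in> carrier_mat p q"
    and E11: "E11 \<in> carrier_mat r r" and E12: "E12 \<in> carrier_mat r q"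
    and E21: "E21 \<in> carrier_mat p r" and E22: "E22 \<in> carrier_mat p q"
    and X: "X \<in> carrier_mat p r" and Z: "Z \<in> carrier_mat q r"
    and eq: "coupled_op G1 G2 (X, Z) = remainder_op E11 E12 E21 E22 (X, Z)"
  shows "coupled_system G1 G2 E11 E12 E21 E22 X Z"
proof -
  have a: "mat_adjoint G1 \<in> carrier_mat r r" "mat_adjoint G2 \<in> carrier_mat q p"
    "mat_adjoint E11 \<in> carrier_mat r r" "mat_adjoint E12 \<in> carrier_mat q r"
    "mat_adjoint E21 \<in> carrier_mat r p" "mat_adjoint E22 \<in> carrier_mat q p"
    using assms by simp_all
  have move: "(P + U) - (Q + V) = A - B" if "P - Q = A - B - (U - V)"
    "P \<in> carrier_mat k s" "Q \<in> carrier_mat k s" "A \<in> carrier_mat k s" "B \<in> carrier_mat k s"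
    "U \<in> carrier_mat k s" "V \<in> carrier_mat k s" for P Q A B U V :: "complex mat" and k s
  proof (rule eq_matI)
    fix i j assume "i < dim_row (A - B)" "j < dim_col (A - B)"
    then show "(P + U - (Q + V)) $$ (i, j) = (A - B) $$ (i, j)"
      using arg_cong[OF that(1), of "\<lambda>M. M $$ (i, j)"] that(2-) by (simp add: algebra_simps)
  qed (use that(2-) in auto)
  have eqs: "X * G1 - G2 * Z = E21 - X * E12 * Z - (X * E11 - E22 * Z)"
    "Z * mat_adjoint G1 - mat_adjoint G2 * X
      = mat_adjoint E12 - Z * mat_adjoint E21 * X - (Z * mat_adjoint E11 - mat_adjoint E22 * X)"
    using eq by (simp_all add: coupled_op_def remainder_op_def quadratic_op_def)
  show ?thesis
    unfolding coupled_system_def mat_adjoint_add[OF G1 E11] mat_adjoint_add[OF G2 E22]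
      mult_add_distrib_mat[OF X G1 E11] add_mult_distrib_mat[OF G2 E22 Z]
      mult_add_distrib_mat[OF Z a(1,3)] add_mult_distrib_mat[OF a(2,6) X]
    by (intro conjI move[OF eqs(1), of p r] move[OF eqs(2), of q r]
        mult_carrier_mat[OF X G1] mult_carrier_mat[OF G2 Z] E21 mult_carrier_mat[OF mult_carrier_mat[OF X E12] Z]
        mult_carrier_mat[OF X E11] mult_carrier_mat[OF E22 Z]
        mult_carrier_mat[OF Z a(1)] mult_carrier_mat[OF a(2) X] a(4) mult_carrier_mat[OF mult_carrier_mat[OF Z a(5)] X]
        mult_carrier_mat[OF Z a(3)] mult_carrier_mat[OF a(6) X])
qed

text \<open>With \<open>s = sqrt (1 - 4 \<kappa>)\<close> one has \<open>1 - 2 \<kappa> + s = (1 + s)\<^sup>2 / 2\<close>. So \<open>b = (2 / (1 + s)) (\<eta> / \<delta>)\<close>,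
the smaller root of the quadratic equation \<open>\<eta> + \<epsilon> b\<^sup>2 = \<delta> b\<close> (if \<open>\<epsilon> > 0\<close>). The equation makes the
ball of radius \<open>b\<close> invariant. As \<open>s > 0\<close>, the parabola crosses the line at \<open>b\<close> with a smaller slope,
\<open>2 \<epsilon> b < \<delta>\<close>, which makes the map a contraction on this ball.\<close>
lemma minimal_radius:
  fixes \<epsilon> \<eta> \<delta> :: real
  assumes \<epsilon>: "0 \<le> \<epsilon>" and \<eta>: "0 \<le> \<eta>" and \<delta>: "0 < \<delta>"
  defines "\<kappa> \<equiv> \<epsilon> / \<delta>\<^sup>2 * \<eta>"
  defines "b \<equiv> (1 + sqrt (1 - 4 * \<kappa>)) / (1 - 2 * \<kappa> + sqrt (1 - 4 * \<kappa>)) * (\<eta> / \<delta>)"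
  assumes \<kappa>: "\<kappa> < 1 / 4"
  shows "0 \<le> b" "\<eta> + \<epsilon> * b\<^sup>2 = \<delta> * b" "2 * \<epsilon> * b < \<delta>" "0 < \<eta> \<Longrightarrow> b < 2 * (\<eta> / \<delta>)"
proof -
  define s where "s = sqrt (1 - 4 * \<kappa>)"
  have s: "0 < s" "s\<^sup>2 = 1 - 4 * \<kappa>" using \<kappa> by (auto simp: s_def)
  have \<epsilon>\<eta>: "\<epsilon> * \<eta> = (1 - s\<^sup>2) / 4 * \<delta>\<^sup>2" using \<delta> s(2) by (simp add: \<kappa>_def field_simps)
  have denom: "1 - 2 * \<kappa> + s = (1 + s)\<^sup>2 / 2" using s(2) by (simp add: power2_eq_square field_simps)
  have "(1 + s) / (1 - 2 * \<kappa> + s) = 2 / (1 + s)"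
    unfolding denom using s(1) by (subst frac_eq_eq) (auto simp: power2_eq_square)
  then have b: "b = 2 / (1 + s) * (\<eta> / \<delta>)" by (simp add: b_def s_def)
  show "0 \<le> b" using b s \<eta> \<delta> by simp
  have b\<eta>: "b * ((1 + s) * \<delta>) = 2 * \<eta>"
  proof -
    have "b * ((1 + s) * \<delta>) = (2 / (1 + s) * (1 + s)) * (\<eta> / \<delta> * \<delta>)"
      unfolding b by (simp only: mult_ac)
    moreover have "2 / (1 + s) * (1 + s) = 2" "\<eta> / \<delta> * \<delta> = \<eta>"
      by (rule nonzero_eq_divide_eq[THEN iffD1, OF _ refl], use s(1) \<delta> in linarith)+
    ultimately show ?thesis by (simp only:)
  qed
  have \<epsilon>b: "\<epsilon> * b = (1 - s) / 2 * \<delta>"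
  proof -
    have "(\<epsilon> * b) * ((1 + s) * \<delta>) = 2 * (\<epsilon> * \<eta>)"
      using arg_cong[OF b\<eta>, of "\<lambda>x. \<epsilon> * x"] by (simp only: mult_ac)
    also have "\<dots> = ((1 - s) / 2 * \<delta>) * ((1 + s) * \<delta>)"
      unfolding \<epsilon>\<eta> by (simp add: power2_eq_square field_simps)
    finally show ?thesis
      by (rule mult_right_cancel[THEN iffD1, rotated]) (use s(1) \<delta> in auto)
  qed
  have "2 * \<epsilon> * b = \<delta> - s * \<delta>" using \<epsilon>b by (simp add: algebra_simps)
  then show "2 * \<epsilon> * b < \<delta>" using s(1) \<delta> by simp
  have "\<eta> = (1 + s) / 2 * (\<delta> * b)" using b\<eta> by (simp add: algebra_simps)
  moreover have "\<epsilon> * b\<^sup>2 = (1 - s) / 2 * (\<delta> * b)"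
    using arg_cong[OF \<epsilon>b, of "\<lambda>x. x * b"] by (simp add: power2_eq_square mult_ac)
  ultimately have "\<eta> + \<epsilon> * b\<^sup>2 = ((1 + s) / 2 + (1 - s) / 2) * (\<delta> * b)"
    by (metis distrib_right)
  also have "(1 + s) / 2 + (1 - s) / 2 = 1" by (simp add: field_simps)
  finally show "\<eta> + \<epsilon> * b\<^sup>2 = \<delta> * b" by simp
  show "b < 2 * (\<eta> / \<delta>)" if "0 < \<eta>"
  proof -
    have "2 / (1 + s) < 2" using s(1) by (simp add: field_simps)
    then show ?thesis unfolding b using that \<delta> by (intro mult_strict_right_mono) auto
  qed
qed

context pair_norm
begin

lemma pnorm_coupled_op_le:
  assumes E11: "E11 \<in> carrier_mat r r" and E22: "E22 \<in> carrier_mat p q"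
    and x: "x \<in> carrier_mat p r \<times> carrier_mat q r"
  shows "pnorm (coupled_op E11 E22 x) \<le> (spectral_norm E11 + spectral_norm E22) * pnorm x"
proof -
  have X: "fst x \<in> carrier_mat p r" and Z: "snd x \<in> carrier_mat q r" using x by auto
  have a: "mat_adjoint E11 \<in> carrier_mat r r" "mat_adjoint E22 \<in> carrier_mat q p" using E11 E22 by simp_all
  let ?g = "frob_norm (fst x)" and ?w = "frob_norm (snd x)"
  let ?e1 = "spectral_norm E11" and ?e2 = "spectral_norm E22"
  have "frob_norm (fst (coupled_op E11 E22 x)) \<le> ?e1 * ?g + ?e2 * ?w"
    unfolding coupled_op_def fst_conv
    using frob_norm_minus[OF mult_carrier_mat[OF X E11] mult_carrier_mat[OF E22 Z]]
      frob_norm_mult_spectral_right[OF X E11] frob_norm_mult_spectral_left[OF E22 Z] by linarith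
  moreover have "frob_norm (snd (coupled_op E11 E22 x)) \<le> ?e1 * ?w + ?e2 * ?g"
    unfolding coupled_op_def snd_conv
    using frob_norm_minus[OF mult_carrier_mat[OF Z a(1)] mult_carrier_mat[OF a(2) X]]
      frob_norm_mult_adjoint_spectral_right[OF Z E11] frob_norm_adjoint_mult_spectral_left[OF E22 X] by linarith
  ultimately have "pnorm (coupled_op E11 E22 x) \<le> nu (?e1 * ?g + ?e2 * ?w) (?e1 * ?w + ?e2 * ?g)"
    unfolding pnorm_def by (intro mono) auto
  also have "\<dots> \<le> nu (?e1 * ?g) (?e1 * ?w) + nu (?e2 * ?w) (?e2 * ?g)"
    by (rule triangle) (auto simp: spectral_norm_nonneg)
  also have "\<dots> = (?e1 + ?e2) * pnorm x"
    by (simp add: scale spectral_norm_nonneg pnorm_def commute[of ?w ?g] distrib_right)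
  finally show ?thesis .
qed

lemma pdist_coupled_op:
  assumes "G1 \<in> carrier_mat r r" "G2 \<in> carrier_mat p q"
    "x \<in> carrier_mat p r \<times> carrier_mat q r" "y \<in> carrier_mat p r \<times> carrier_mat q r"
  shows "pdist (coupled_op G1 G2 x) (coupled_op G1 G2 y) = pnorm (coupled_op G1 G2 (fst x - fst y, snd x - snd y))"
  unfolding coupled_op_diff[OF assms] by (simp add: pnorm_def pdist_def)

lemma pnorm_diff: "pnorm (fst x - fst y, snd x - snd y) = pdist x y"
  by (simp add: pnorm_def pdist_def)

lemma pnorm_quadratic_op_le:
  assumes E12: "E12 \<in> carrier_mat r q" and E21: "E21 \<in> carrier_mat p r"
    and \<epsilon>: "spectral_norm E12 \<le> \<epsilon>" "spectral_norm E21 \<le> \<epsilon>"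
    and x: "x \<in> carrier_mat p r \<times> carrier_mat q r"
  shows "pnorm (quadratic_op E12 E21 x) \<le> \<epsilon> * (pnorm x)\<^sup>2"
proof -
  have X: "fst x \<in> carrier_mat p r" and Z: "snd x \<in> carrier_mat q r" using x by auto
  have a: "mat_adjoint E21 \<in> carrier_mat r p" using E21 by simp
  have \<epsilon>0: "0 \<le> \<epsilon>" using \<epsilon>(1) spectral_norm_nonneg order_trans by blast
  let ?g = "frob_norm (fst x)" and ?w = "frob_norm (snd x)"
  have "frob_norm (fst x * E12) \<le> \<epsilon> * ?g"
    using frob_norm_mult_spectral_right[OF X E12] mult_right_mono[OF \<epsilon>(1), of ?g] by simp
  moreover have "frob_norm (snd x * mat_adjoint E21) \<le> \<epsilon> * ?w"
    using frob_norm_mult_adjoint_spectral_right[OF Z E21] mult_right_mono[OF \<epsilon>(2), of ?w] by simp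
  ultimately have "pnorm (quadratic_op E12 E21 x) \<le> nu (\<epsilon> * (?g * ?w)) (\<epsilon> * (?w * ?g))"
    unfolding pnorm_def quadratic_op_def fst_conv snd_conv
    by (intro mono frob_norm_triple_le[OF X E12 Z] frob_norm_triple_le[OF Z a X]) auto
  also have "\<dots> \<le> \<epsilon> * (nu ?g ?w * nu ?g ?w)"
    using cross[of ?g ?w ?g ?w] \<epsilon>0 by (simp add: scale mult_left_mono)
  finally show ?thesis by (simp add: pnorm_def power2_eq_square)
qed

lemma pdist_quadratic_op_le:
  assumes E12: "E12 \<in> carrier_mat r q" and E21: "E21 \<in> carrier_mat p r"
    and \<epsilon>: "spectral_norm E12 \<le> \<epsilon>" "spectral_norm E21 \<le> \<epsilon>"
    and x: "x \<in> carrier_mat p r \<times> carrier_mat q r" and y: "y \<in> carrier_mat p r \<times> carrier_mat q r"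
  shows "pdist (quadratic_op E12 E21 x) (quadratic_op E12 E21 y) \<le> \<epsilon> * (pnorm x + pnorm y) * pdist x y"
proof -
  have X: "fst x \<in> carrier_mat p r" "fst y \<in> carrier_mat p r"
    and Z: "snd x \<in> carrier_mat q r" "snd y \<in> carrier_mat q r" using x y by auto
  have a: "mat_adjoint E21 \<in> carrier_mat r p" using E21 by simp
  have \<epsilon>0: "0 \<le> \<epsilon>" using \<epsilon>(1) spectral_norm_nonneg order_trans by blast
  let ?g = "frob_norm (fst x)" and ?w = "frob_norm (snd x)"
  let ?g' = "frob_norm (fst y)" and ?w' = "frob_norm (snd y)"
  let ?dg = "frob_norm (fst x - fst y)" and ?dw = "frob_norm (snd x - snd y)"
  have 1: "frob_norm (A * E12) \<le> \<epsilon> * frob_norm A" if "A \<in> carrier_mat p r" for A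
    using frob_norm_mult_spectral_right[OF that E12] mult_right_mono[OF \<epsilon>(1), of "frob_norm A"] by simp
  have 2: "frob_norm (A * mat_adjoint E21) \<le> \<epsilon> * frob_norm A" if "A \<in> carrier_mat q r" for A
    using frob_norm_mult_adjoint_spectral_right[OF that E21] mult_right_mono[OF \<epsilon>(2), of "frob_norm A"] by simp
  have "pdist (quadratic_op E12 E21 x) (quadratic_op E12 E21 y)
      \<le> nu (\<epsilon> * (?dg * ?w + ?g' * ?dw)) (\<epsilon> * (?dw * ?g + ?w' * ?dg))"
    unfolding pdist_def quadratic_op_def fst_conv snd_conv
    by (intro mono frob_norm_triple_diff_le[OF X E12 Z 1] frob_norm_triple_diff_le[OF Z a X 2]) auto
  also have "\<dots> = \<epsilon> * nu (?dg * ?w + ?g' * ?dw) (?dw * ?g + ?w' * ?dg)"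
    using \<epsilon>0 by (intro scale) auto
  also have "\<dots> \<le> \<epsilon> * (nu (?dg * ?w) (?dw * ?g) + nu (?g' * ?dw) (?w' * ?dg))"
    by (intro mult_left_mono triangle \<epsilon>0) auto
  also have "\<dots> \<le> \<epsilon> * (nu ?dg ?dw * nu ?g ?w + nu ?g' ?w' * nu ?dg ?dw)"
    by (intro mult_left_mono add_mono cross \<epsilon>0) auto
  also have "\<dots> = \<epsilon> * (pnorm x + pnorm y) * pdist x y"
    by (simp add: pnorm_def pdist_def algebra_simps)
  finally show ?thesis .
qed

text \<open>Both parts of the final theorem are instances; they differ in the norm on pairs and in the
reason for \<open>lower\<close>. On the ball of radius \<open>\<rho>\<close> the right-hand side is bounded by
\<open>\<eta> + \<epsilon> \<rho>\<^sup>2 + (\<parallel>E11\<parallel> + \<parallel>E22\<parallel>) \<rho>\<close>, where \<open>\<eta>\<close> is the norm of the constant term, and has the Lipschitz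
constant \<open>2 \<epsilon> \<rho> + \<parallel>E11\<parallel> + \<parallel>E22\<parallel>\<close>. The two conditions on \<open>\<rho>\<close> say that these do not exceed
\<open>\<delta> \<rho>\<close>, respectively are less than \<open>\<delta>\<close>.\<close>
theorem coupled_system_solution_in_ball:
  fixes G1 G2 E11 E12 E21 E22 :: "complex mat" and p q r :: nat
  assumes G1: "G1 \<in> carrier_mat r r" and G2: "G2 \<in> carrier_mat p q"
    and E11: "E11 \<in> carrier_mat r r" and E12: "E12 \<in> carrier_mat r q"
    and E21: "E21 \<in> carrier_mat p r" and E22: "E22 \<in> carrier_mat p q"
    and lower: "\<And>x. x \<in> carrier_mat p r \<times> carrier_mat q r \<Longrightarrow> \<delta> * pnorm x \<le> pnorm (coupled_op G1 G2 x)"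
    and surj: "\<And>y. y \<in> carrier_mat p r \<times> carrier_mat q r \<Longrightarrow>
      \<exists>x \<in> carrier_mat p r \<times> carrier_mat q r. coupled_op G1 G2 x = y"
    and \<epsilon>: "spectral_norm E12 \<le> \<epsilon>" "spectral_norm E21 \<le> \<epsilon>"
    and \<delta>l: "\<delta>l = \<delta> - spectral_norm E11 - spectral_norm E22" "0 < \<delta>l"
    and \<rho>: "0 \<le> \<rho>" "nu (frob_norm E12) (frob_norm E21) + \<epsilon> * \<rho>\<^sup>2 \<le> \<delta>l * \<rho>" "2 * \<epsilon> * \<rho> < \<delta>l"
  shows "\<exists>X \<in> carrier_mat p r. \<exists>Z \<in> carrier_mat q r.
    coupled_system G1 G2 E11 E12 E21 E22 X Z \<and> nu (frob_norm X) (frob_norm Z) \<le> \<rho>"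
proof -
  let ?S = "carrier_mat p r \<times> carrier_mat q r :: (complex mat \<times> complex mat) set"
  let ?e = "spectral_norm E11 + spectral_norm E22"
  let ?T = "coupled_op G1 G2" and ?P = "coupled_op E11 E22" and ?B = "quadratic_op E12 E21"
  let ?R = "remainder_op E11 E12 E21 E22"
  have e0: "0 \<le> ?e" by (simp add: spectral_norm_nonneg)
  have \<epsilon>0: "0 \<le> \<epsilon>" using \<epsilon>(1) spectral_norm_nonneg order_trans by blast
  have E12a: "mat_adjoint E12 \<in> carrier_mat q r" and E21a: "mat_adjoint E21 \<in> carrier_mat r p"
    using E12 E21 by simp_all
  have diff_carrier: "(fst x - fst y, snd x - snd y) \<in> ?S" if "x \<in> ?S" "y \<in> ?S" for x y
  proof -
    have "fst y \<in> carrier_mat p r" "snd y \<in> carrier_mat q r" using that(2) by auto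
    then show ?thesis by (simp add: minus_carrier_mat)
  qed
  have Bc: "fst (?B x) \<in> carrier_mat p r" "snd (?B x) \<in> carrier_mat q r" if "x \<in> ?S" for x
  proof -
    have "fst x \<in> carrier_mat p r" "snd x \<in> carrier_mat q r" using that by auto
    then show "fst (?B x) \<in> carrier_mat p r" "snd (?B x) \<in> carrier_mat q r"
      unfolding quadratic_op_def fst_conv snd_conv
      using mult_carrier_mat[OF mult_carrier_mat[OF _ E12]] mult_carrier_mat[OF mult_carrier_mat[OF _ E21a]] by blast+
  qed
  have Pc: "fst (?P x) \<in> carrier_mat p r" "snd (?P x) \<in> carrier_mat q r" if "x \<in> ?S" for x
    using coupled_op_carrier[OF E11 E22 that] by auto
  have Rc: "?R x \<in> ?S" if "x \<in> ?S" for x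
    unfolding remainder_op_def mem_Times_iff fst_conv snd_conv
    using minus_carrier_mat[OF Pc(1)[OF that]] minus_carrier_mat[OF Pc(2)[OF that]] by blast
  have "\<exists>x \<in> ?S. pnorm x \<le> \<rho> \<and> ?T x = ?R x"
  proof (rule perturbed_equation_solvable[where \<delta> = \<delta> and L = "2 * \<epsilon> * \<rho> + ?e"])
    show "0 < \<delta>" using \<delta>l e0 by simp
    show "0 \<le> \<rho>" by (rule \<rho>(1))
    show "2 * \<epsilon> * \<rho> + ?e < \<delta>" using \<rho>(3) \<delta>l(1) by simp
    show "\<delta> * pnorm x \<le> pnorm (?T x)" if "x \<in> ?S" for x by (rule lower[OF that])
    show "\<delta> * pdist x y \<le> pdist (?T x) (?T y)" if "x \<in> ?S" "y \<in> ?S" for x y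
      using lower[OF diff_carrier[OF that]]
      unfolding pdist_coupled_op[OF G1 G2 that] pnorm_diff .
    show "\<exists>x \<in> ?S. ?T x = y" if "y \<in> ?S" for y by (rule surj[OF that])
    show "?R x \<in> ?S" if "x \<in> ?S" for x by (rule Rc[OF that])
    show "pnorm (?R x) \<le> \<delta> * \<rho>" if x: "x \<in> ?S" "pnorm x \<le> \<rho>" for x
    proof -
      have sub3: "frob_norm (A - B - C) \<le> frob_norm A + frob_norm B + frob_norm C"
        if "A \<in> carrier_mat k s" "B \<in> carrier_mat k s" "C \<in> carrier_mat k s" for A B C :: "complex mat" and k s
        using frob_norm_minus[OF minus_carrier_mat[OF that(2), of A] that(3)] frob_norm_minus[OF that(1,2)] by linarith
      have "pnorm (?R x) \<le> nu (frob_norm E21 + frob_norm (fst (?B x)) + frob_norm (fst (?P x)))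
          (frob_norm (mat_adjoint E12) + frob_norm (snd (?B x)) + frob_norm (snd (?P x)))"
        unfolding pnorm_def remainder_op_def fst_conv snd_conv
        by (intro mono sub3[OF E21 Bc(1)[OF x(1)] Pc(1)[OF x(1)]] sub3[OF E12a Bc(2)[OF x(1)] Pc(2)[OF x(1)]]) auto
      also have "\<dots> \<le> nu (frob_norm E21) (frob_norm (mat_adjoint E12)) + pnorm (?B x) + pnorm (?P x)"
        unfolding pnorm_def by (rule triangle3) auto
      also have "\<dots> \<le> nu (frob_norm E12) (frob_norm E21) + \<epsilon> * \<rho>\<^sup>2 + ?e * \<rho>"
      proof (intro add_mono)
        show "nu (frob_norm E21) (frob_norm (mat_adjoint E12)) \<le> nu (frob_norm E12) (frob_norm E21)"
          by (simp add: commute)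
        have "pnorm (?B x) \<le> \<epsilon> * (pnorm x)\<^sup>2"
          by (rule pnorm_quadratic_op_le[OF E12 E21 \<epsilon> x(1)])
        also have "\<dots> \<le> \<epsilon> * \<rho>\<^sup>2"
          by (intro mult_left_mono power_mono x(2) pnorm_nonneg \<epsilon>0)
        finally show "pnorm (?B x) \<le> \<epsilon> * \<rho>\<^sup>2" .
        have "pnorm (?P x) \<le> ?e * pnorm x"
          by (rule pnorm_coupled_op_le[OF E11 E22 x(1)])
        also have "\<dots> \<le> ?e * \<rho>" by (intro mult_left_mono x(2) e0)
        finally show "pnorm (?P x) \<le> ?e * \<rho>" .
      qed
      also have "\<dots> \<le> \<delta>l * \<rho> + ?e * \<rho>" using \<rho>(2) by simp
      also have "\<dots> = \<delta> * \<rho>" by (simp add: \<delta>l(1) algebra_simps)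
      finally show ?thesis .
    qed
    show "pdist (?R x) (?R y) \<le> (2 * \<epsilon> * \<rho> + ?e) * pdist x y"
      if xy: "x \<in> ?S" "y \<in> ?S" "pnorm x \<le> \<rho>" "pnorm y \<le> \<rho>" for x y
    proof -
      have sub: "frob_norm ((A - B - C) - (A - B' - C')) \<le> frob_norm (B - B') + frob_norm (C - C')"
        if "A \<in> carrier_mat k s" "B \<in> carrier_mat k s" "C \<in> carrier_mat k s" "B' \<in> carrier_mat k s" "C' \<in> carrier_mat k s"
        for A B C B' C' :: "complex mat" and k s
      proof -
        have "(A - B - C) - (A - B' - C') = - ((B - B') + (C - C'))" using that by (intro eq_matI) auto
        then show ?thesis
          using frob_norm_add[OF minus_carrier_mat[OF that(4), of B] minus_carrier_mat[OF that(5), of C]]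
          by (simp add: frob_norm_uminus)
      qed
      have "pdist (?R x) (?R y) \<le> nu (frob_norm (fst (?B x) - fst (?B y)) + frob_norm (fst (?P x) - fst (?P y)))
          (frob_norm (snd (?B x) - snd (?B y)) + frob_norm (snd (?P x) - snd (?P y)))"
        unfolding pdist_def remainder_op_def fst_conv snd_conv
        by (intro mono sub[OF E21 Bc(1)[OF xy(1)] Pc(1)[OF xy(1)] Bc(1)[OF xy(2)] Pc(1)[OF xy(2)]]
            sub[OF E12a Bc(2)[OF xy(1)] Pc(2)[OF xy(1)] Bc(2)[OF xy(2)] Pc(2)[OF xy(2)]]) auto
      also have "\<dots> \<le> pdist (?B x) (?B y) + pdist (?P x) (?P y)"
        unfolding pdist_def by (rule triangle) auto
      also have "\<dots> \<le> 2 * \<epsilon> * \<rho> * pdist x y + ?e * pdist x y"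
      proof (intro add_mono)
        have "pdist (?B x) (?B y) \<le> \<epsilon> * (pnorm x + pnorm y) * pdist x y"
          by (rule pdist_quadratic_op_le[OF E12 E21 \<epsilon> xy(1,2)])
        also have "\<dots> \<le> \<epsilon> * (\<rho> + \<rho>) * pdist x y"
          by (intro mult_left_mono mult_right_mono add_mono xy \<epsilon>0 pdist_nonneg)
        finally show "pdist (?B x) (?B y) \<le> 2 * \<epsilon> * \<rho> * pdist x y" by (simp add: algebra_simps)
        show "pdist (?P x) (?P y) \<le> ?e * pdist x y"
          using pnorm_coupled_op_le[OF E11 E22 diff_carrier[OF xy(1,2)]]
          unfolding pdist_coupled_op[OF E11 E22 xy(1,2)] pnorm_diff .
      qed
      finally show ?thesis by (simp add: distrib_right)
    qed
  qed
  then obtain X Z where XZ: "X \<in> carrier_mat p r" "Z \<in> carrier_mat q r" "pnorm (X, Z) \<le> \<rho>" "?T (X, Z) = ?R (X, Z)"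
    by auto
  show ?thesis
    using coupled_system_if_remainder[OF G1 G2 E11 E12 E21 E22 XZ(1,2,4)] XZ(1,2,3)
    by (auto simp: pnorm_def)
qed

end

theorem corollary4p1:
  fixes r m n :: nat
    and G Gt E U V G1 G2 E11 E12 E21 E22 :: "complex mat"
    and \<delta> \<delta>l \<epsilon> :: real
  assumes r: "1 \<le> r" "r < min m n"
    and G: "G \<in> carrier_mat m n"
    and E: "E \<in> carrier_mat m n"
    and Gt: "Gt = G + E"
    and U: "unitary_mat m U"
    and V: "unitary_mat n V"
    and G1: "G1 \<in> carrier_mat r r"
    and G2: "G2 \<in> carrier_mat (m - r) (n - r)"
    and E11: "E11 \<in> carrier_mat r r"
    and E12: "E12 \<in> carrier_mat r (n - r)"
    and E21: "E21 \<in> carrier_mat (m - r) r"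
    and E22: "E22 \<in> carrier_mat (m - r) (n - r)"
    and decomp_G:
      "mat_adjoint U * G * V = four_block_mat G1 (0\<^sub>m r (n - r)) (0\<^sub>m (m - r) r) G2"
    and decomp_Gt:
      "mat_adjoint U * Gt * V = four_block_mat (G1 + E11) E12 E21 (G2 + E22)"
    and \<delta>: "\<delta> = Min {\<bar>\<mu> - \<nu>\<bar> | \<mu> \<nu>. \<mu> \<in># sv G1 \<and> \<nu> \<in># sv_ext G2}"
    and \<delta>l: "\<delta>l = \<delta> - spectral_norm E11 - spectral_norm E22"
    and \<epsilon>: "\<epsilon> = max (spectral_norm E12) (spectral_norm E21)"
  shows
    "(let \<eta> = sqrt ((frob_norm E12)\<^sup>2 + (frob_norm E21)\<^sup>2);
          \<kappa> = \<epsilon> / \<delta>l\<^sup>2 * \<eta>;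
          b = (1 + sqrt (1 - 4 * \<kappa>)) / (1 - 2 * \<kappa> + sqrt (1 - 4 * \<kappa>)) * (\<eta> / \<delta>l)
      in \<delta>l > 0 \<and> \<kappa> < 1 / 4 \<longrightarrow>
         (\<exists>\<Gamma> \<in> carrier_mat (m - r) r. \<exists>\<Omega> \<in> carrier_mat (n - r) r.
            coupled_system G1 G2 E11 E12 E21 E22 \<Gamma> \<Omega> \<and>
            sqrt ((frob_norm \<Gamma>)\<^sup>2 + (frob_norm \<Omega>)\<^sup>2) \<le> b \<and>
            (\<not> (E12 = 0\<^sub>m r (n - r) \<and> E21 = 0\<^sub>m (m - r) r) \<longrightarrow> b < 2 * (\<eta> / \<delta>l))))
     \<and>
     (let \<eta> = max (frob_norm E12) (frob_norm E21);
          \<kappa> = \<epsilon> / \<delta>l\<^sup>2 * \<eta>;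
          b = (1 + sqrt (1 - 4 * \<kappa>)) / (1 - 2 * \<kappa> + sqrt (1 - 4 * \<kappa>)) * (\<eta> / \<delta>l)
      in sigma_min G1 > sigma_max G2 \<and> \<delta>l > 0 \<and> \<kappa> < 1 / 4 \<longrightarrow>
         (\<exists>\<Gamma> \<in> carrier_mat (m - r) r. \<exists>\<Omega> \<in> carrier_mat (n - r) r.
            coupled_system G1 G2 E11 E12 E21 E22 \<Gamma> \<Omega> \<and>
            max (frob_norm \<Gamma>) (frob_norm \<Omega>) \<le> b \<and>
            (\<not> (E12 = 0\<^sub>m r (n - r) \<and> E21 = 0\<^sub>m (m - r) r) \<longrightarrow> b < 2 * (\<eta> / \<delta>l))))"
proof -
  let ?p = "m - r" and ?q = "n - r"
  let ?S = "carrier_mat ?p r \<times> carrier_mat ?q r :: (complex mat \<times> complex mat) set"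
  have \<epsilon>': "spectral_norm E12 \<le> \<epsilon>" "spectral_norm E21 \<le> \<epsilon>" by (auto simp: \<epsilon>)
  then have \<epsilon>0: "0 \<le> \<epsilon>" using spectral_norm_nonneg order_trans by blast
  have "{\<bar>\<mu> - \<nu>\<bar> | \<mu> \<nu>. \<mu> \<in># sv G1 \<and> \<nu> \<in># sv_ext G2}
      = (\<lambda>(\<mu>, \<nu>). \<bar>\<mu> - \<nu>\<bar>) ` (set_mset (sv G1) \<times> set_mset (sv_ext G2))"
    by auto
  then have gap: "\<delta> \<le> \<bar>\<mu> - \<nu>\<bar>" if "\<mu> \<in># sv G1" "\<nu> \<in># sv_ext G2" for \<mu> \<nu>
    unfolding \<delta> using that by (auto intro!: Min_le)
  have \<delta>l_le: "\<delta>l \<le> \<delta>" using spectral_norm_nonneg[of E11] spectral_norm_nonneg[of E22] by (simp add: \<delta>l)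
  have surj: "\<exists>x \<in> ?S. coupled_op G1 G2 x = y" if "y \<in> ?S" "0 < \<delta>l" for y
  proof (rule coupled_op_surjective[OF G1 G2 _ that(1)])
    show "set_mset (sv G1) \<inter> set_mset (sv_ext G2) = {}"
      using gap \<delta>l_le that(2) by fastforce
  qed
  have solution: "\<exists>\<Gamma> \<in> carrier_mat ?p r. \<exists>\<Omega> \<in> carrier_mat ?q r.
      coupled_system G1 G2 E11 E12 E21 E22 \<Gamma> \<Omega> \<and> nu (frob_norm \<Gamma>) (frob_norm \<Omega>) \<le> b \<and>
      (\<not> (E12 = 0\<^sub>m r ?q \<and> E21 = 0\<^sub>m ?p r) \<longrightarrow> b < 2 * (\<eta> / \<delta>l))"
    if nu: "pair_norm nu" and \<eta>: "\<eta> = nu (frob_norm E12) (frob_norm E21)"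
      and \<kappa>: "\<kappa> = \<epsilon> / \<delta>l\<^sup>2 * \<eta>"
      and b: "b = (1 + sqrt (1 - 4 * \<kappa>)) / (1 - 2 * \<kappa> + sqrt (1 - 4 * \<kappa>)) * (\<eta> / \<delta>l)"
      and pos: "0 < \<delta>l" "\<kappa> < 1 / 4"
      and lower: "\<And>x. x \<in> ?S \<Longrightarrow> \<delta> * pair_norm.pnorm nu x \<le> pair_norm.pnorm nu (coupled_op G1 G2 x)"
    for nu \<eta> \<kappa> b
  proof -
    interpret pair_norm nu by (rule nu)
    have \<eta>0: "0 \<le> \<eta>" unfolding \<eta> by (rule nonneg) auto
    note radius = minimal_radius[OF \<epsilon>0 \<eta>0 pos(1), folded \<kappa>, OF pos(2), folded b]
    \<comment> \<open>The strict inequality is claimed only in this case: for \<open>\<eta> = 0\<close> both sides are zero.\<close>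
    have "0 < \<eta>" if "\<not> (E12 = 0\<^sub>m r ?q \<and> E21 = 0\<^sub>m ?p r)"
    proof (rule ccontr)
      assume "\<not> 0 < \<eta>"
      then have "frob_norm E12 \<le> 0" "frob_norm E21 \<le> 0"
        using ge[of "frob_norm E12" "frob_norm E21"] ge2[of "frob_norm E12" "frob_norm E21"] by (auto simp: \<eta>)
      then have "frob_norm E12 = 0" "frob_norm E21 = 0" by (auto intro: antisym)
      then show False using frob_norm_eq_0[OF E12] frob_norm_eq_0[OF E21] that by blast
    qed
    moreover have "\<exists>\<Gamma> \<in> carrier_mat ?p r. \<exists>\<Omega> \<in> carrier_mat ?q r.
        coupled_system G1 G2 E11 E12 E21 E22 \<Gamma> \<Omega> \<and> nu (frob_norm \<Gamma>) (frob_norm \<Omega>) \<le> b"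
      by (rule coupled_system_solution_in_ball[OF G1 G2 E11 E12 E21 E22 lower surj[OF _ pos(1)] \<epsilon>' \<delta>l pos(1) radius(1) _ radius(3)])
        (use radius(2) in \<open>simp_all add: \<eta>\<close>)
    ultimately show ?thesis using radius(4) by blast
  qed
  show ?thesis
    unfolding Let_def
  proof (intro conjI impI, goal_cases)
    case 1
    have pos: "0 < \<delta>l" using 1 by simp
    have "\<epsilon> / \<delta>l\<^sup>2 * sqrt ((frob_norm E12)\<^sup>2 + (frob_norm E21)\<^sup>2) < 1 / 4"
      using 1 by simp
    from solution[OF pair_norm_euclidean refl refl refl pos this]
    show ?case
      using coupled_op_lower_bound_frobenius[OF G1 G2, of \<delta>] gap pos \<delta>l_le
      by (simp add: pair_norm.pnorm_def[OF pair_norm_euclidean])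
  next
    case 2
    have sep: "sigma_max G2 < sigma_min G1" and pos: "0 < \<delta>l"
      and \<kappa>: "\<epsilon> / \<delta>l\<^sup>2 * max (frob_norm E12) (frob_norm E21) < 1 / 4"
      using 2 by simp_all
    have dims: "0 < min (dim_row G1) (dim_col G1)" "0 < min (dim_row G2) (dim_col G2)"
      using r G1 G2 by auto
    have b0: "0 \<le> sigma_max G2" by (rule sv_nonneg[OF sigma_max_props(1)[OF dims(2)]])
    have ext: "\<nu> \<le> sigma_max G2" if "\<nu> \<in># sv_ext G2" for \<nu>
      using that sigma_max_props(2)[OF dims(2)] b0 by (auto simp: sv_ext_def split: if_splits)
    have "sigma_max G2 \<in># sv_ext G2"
      using sigma_max_props(1)[OF dims(2)] by (simp add: sv_ext_def)
    then have \<delta>_le: "\<delta> \<le> sigma_min G1 - sigma_max G2"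
      using gap[OF sigma_min_props(1)[OF dims(1)]] sep by fastforce
    have lower: "\<delta> * max (frob_norm (fst x)) (frob_norm (snd x))
        \<le> max (frob_norm (fst (coupled_op G1 G2 x))) (frob_norm (snd (coupled_op G1 G2 x)))" if "x \<in> ?S" for x
    proof -
      have "\<delta> * max (frob_norm (fst x)) (frob_norm (snd x))
          \<le> (sigma_min G1 - sigma_max G2) * max (frob_norm (fst x)) (frob_norm (snd x))"
        by (rule mult_right_mono[OF \<delta>_le]) (simp add: le_max_iff_disj)
      also have "\<dots> \<le> max (frob_norm (fst (coupled_op G1 G2 x))) (frob_norm (snd (coupled_op G1 G2 x)))"
        using coupled_op_lower_bound_max[OF G1 G2 _ sigma_min_props(2)[OF dims(1)] b0 ext that] b0 sep by simp
      finally show ?thesis .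
    qed
    from solution[OF pair_norm_max refl refl refl pos \<kappa>] lower
    show ?case
      by (simp add: pair_norm.pnorm_def[OF pair_norm_max])
  qed
qed

end
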